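(* Let $k\geq 1$ be an integer and let $\varepsilon>0$ be fixed and small. For large $X,Y$ with \[ X^{\frac{\varepsilon}{3k}} \ll Y \ll \left(\frac{X}{(\log X)^2}\right)^{\frac{1}{3k}}, \] we have \[ S_k(X,Y) \asymp_{k,\varepsilon} X Y^{k} (\log X)^{2k^2-k}, \] where \[ S_k(X,Y) := \sum_{\chi \in S(X)} \left|\sum_{n \leq Y}\chi(n)\right|^{2k}. \]
   Context: $S(X)$ denotes the set of all non-principal quadratic Dirichlet characters of modulus at most $X$. Concretely (as in the paper), these are the characters $\chi_D(n)=\left(\frac{D}{n}\right)$ (Kronecker symbol) where $D$ runs over integers with $|D|\leq X$, $D$ not a perfect square and $D\equiv 0,1 \pmod 4$. The notation $A\asymp_{k,\varepsilon} B$ means $A\ll B\ll A$ with implied constants depending only on $k,\varepsilon$. *)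

theory Defs
  imports "HOL-Number_Theory.Number_Theory" "HOL-Computational_Algebra.Nth_Powers" Complex_Main
begin

text \<open>
  The Kronecker symbol \<open>(a/n)\<close>. At odd primes it is the Legendre symbol; the values at
  \<open>2\<close>, \<open>-1\<close> and \<open>0\<close> are the usual conventions.
\<close>

definition kronecker_prime :: "int \<Rightarrow> int \<Rightarrow> int" where
  "kronecker_prime a p =
     (if p = 2 then
        (if even a then 0 else if a mod 8 \<in> {1, 7} then 1 else - 1)
      else Legendre a p)"

definition kronecker :: "int \<Rightarrow> int \<Rightarrow> int" where
  "kronecker a n =
     (if n = 0 then (if \<bar>a\<bar> = 1 then 1 else 0)
      else (if n < 0 \<and> a < 0 then - 1 else 1) *
           (\<Prod>p\<in>prime_factors n. kronecker_prime a p ^ multiplicity p n))"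

text \<open>
  The non-principal quadratic characters of modulus at most \<open>X\<close>, represented by the integers
  \<open>D\<close> of the characters \<open>n \<mapsto> kronecker D n\<close> of modulus \<open>\<bar>D\<bar>\<close>.
  Different \<open>D\<close> are different characters (\<open>D\<close> and \<open>-D\<close> differ at \<open>-1\<close>), although characters
  of different moduli may agree as functions, e.g. for \<open>D = 8\<close> and \<open>D = 32\<close>.
\<close>

definition quad_chars :: "real \<Rightarrow> int set" where
  "quad_chars X = {D. real_of_int \<bar>D\<bar> \<le> X \<and> \<not> is_square D \<and> D mod 4 \<in> {0, 1}}"

definition char_moment :: "nat \<Rightarrow> real \<Rightarrow> real \<Rightarrow> real" where
  "char_moment k X Y =
     (\<Sum>D\<in>quad_chars X. \<bar>\<Sum>n\<in>{1..\<lfloor>Y\<rfloor>}. real_of_int (kronecker D n)\<bar> ^ (2 * k))"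

end

theory Submission
  imports Defs "HOL-Library.FuncSet" "HOL-Computational_Algebra.Squarefree"
    "HOL-Real_Asymp.Real_Asymp"
begin

text \<open>
  Expanding the power turns the moment into a sum over tuples \<open>v\<close> of \<open>2k\<close> numbers up to \<open>Y\<close> of
  the sums of \<open>D \<mapsto> (D/m)\<close>, where \<open>m\<close> is the product of \<open>v\<close>. On the discriminants this function of
  \<open>D\<close> has period \<open>8m\<close>, and its sum over a period vanishes if \<open>m\<close> is not a square. In the given
  range of \<open>Y\<close> the trivial bound \<open>8m\<close> for an incomplete period suffices, since
  \<open>Y^(4k) \<le> X Y^k / (log X)^2\<close> up to constants; the Polya-Vinogradov inequality is not needed.
  Tuples with square product contribute \<open>X \<phi>(m)/m\<close> up to constants, so it remains to count them
  with this weight.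

  The product of \<open>n_1, ..., n_r\<close> is a square iff \<open>n_i = d_i^2 \<Prod>_j a_{ij}\<close> for some symmetric
  \<open>a\<close>. Summing over the \<open>d_i\<close> first leaves \<open>Y^(r/2)\<close> times the sum of \<open>1 / \<Prod> a_{ij}\<close>,
  hence one logarithm for each of the \<open>r choose 2\<close> pairs and no input on primes. For the lower
  bound the \<open>a_{ij}\<close> are restricted to numbers coprime to \<open>K!\<close>: with a large \<open>K\<close>, a positive
  proportion of these families is squarefree and pairwise coprime, and for them the
  parametrization is injective.
\<close>

section \<open>The Kronecker symbol\<close>

text \<open>Covering and injectivity are used separately. The upper bound asks only that the
  parametrization reach every tuple with square product, the lower bound only that it be injective
  on a rich set of parameters; so no canonical choice of the a_ij is ever made. The obstacle in the
  lower bound is that being squarefree and pairwise coprime is a condition on all primes at once. A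
  union bound over all divisors j > 1 costs a multiple of the sum of 1/j^2, which drops below 1/2
  once the sum starts beyond a large K. Hence the removal of the small primes, whose price is a
  constant factor in each logarithm. The weights totient(m)/m are handled without computing mean
  values: the Euler product is linearized, and the resulting sums over divisors again converge like
  the sum of 1/j^2. The lower end of the range of Y makes ln Y comparable to ln X, which turns
  powers of ln Y into powers of ln X.\<close>

lemma Legendre_mult:
  assumes "prime p" "2 < p"
  shows "Legendre (a * b) (int p) = Legendre a (int p) * Legendre b (int p)"
proof -
  have "[Legendre (a * b) (int p) = (a * b) ^ ((p - 1) div 2)] (mod int p)"
    using assms by (rule euler_criterion)
  moreover have "[Legendre a (int p) * Legendre b (int p) =
      a ^ ((p - 1) div 2) * b ^ ((p - 1) div 2)] (mod int p)"
    using assms by (intro cong_mult euler_criterion)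
  ultimately have "[Legendre (a * b) (int p) = Legendre a (int p) * Legendre b (int p)] (mod int p)"
    by (metis cong_sym cong_trans power_mult_distrib)
  hence "int p dvd Legendre (a * b) (int p) - Legendre a (int p) * Legendre b (int p)"
    by (simp add: cong_iff_dvd_diff)
  \<comment> \<open>Both sides lie in {-1, 0, 1}, so they differ by at most 2, and a difference
    divisible by \<open>p\<close> > 2 vanishes.\<close>
  moreover have "\<bar>Legendre (a * b) (int p) - Legendre a (int p) * Legendre b (int p)\<bar> < int p"
    using assms(2) by (auto simp: Legendre_def)
  ultimately have "Legendre (a * b) (int p) - Legendre a (int p) * Legendre b (int p) = 0"
    using dvd_imp_le_int[of "Legendre (a * b) (int p) - Legendre a (int p) * Legendre b (int p)" "int p"]
    by linarith
  thus ?thesis by simp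
qed

lemma Legendre_cong:
  assumes "[a = b] (mod p)"
  shows "Legendre a p = Legendre b p"
proof -
  have "[x = a] (mod p) \<longleftrightarrow> [x = b] (mod p)" for x
    using assms cong_sym cong_trans by blast
  moreover have "[a = 0] (mod p) \<longleftrightarrow> [b = 0] (mod p)"
    using assms cong_sym cong_trans by blast
  ultimately show ?thesis unfolding Legendre_def QuadRes_def by simp
qed

lemma even_iff_even_mod_8: "even a \<longleftrightarrow> even (a mod 8)" for a :: int
  by (rule dvd_mod_iff [symmetric]) simp

lemma kronecker_prime_mult:
  assumes "prime p"
  shows "kronecker_prime (a * b) p = kronecker_prime a p * kronecker_prime b p"
proof (cases "p = 2")
  case True
  \<comment> \<open>At 2 the symbol depends only on the residue modulo 8, so multiplicativity is a
    check of 64 cases.\<close>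
  define x y z where "x = a mod 8" and "y = b mod 8" and "z = a * b mod 8"
  have z: "z = x * y mod 8"
    unfolding x_def y_def z_def by (simp add: mod_mult_eq)
  have cases: "x mod 8 = 0 \<or> x mod 8 = 1 \<or> x mod 8 = 2 \<or> x mod 8 = 3 \<or> x mod 8 = 4 \<or>
      x mod 8 = 5 \<or> x mod 8 = 6 \<or> x mod 8 = 7" for x :: int
    using pos_mod_bound[of 8 x] pos_mod_sign[of 8 x] by linarith
  have def2: "kronecker_prime x 2 =
      (if even (x mod 8) then 0 else if x mod 8 \<in> {1, 7} then 1 else - 1)" for x
    unfolding kronecker_prime_def using even_iff_even_mod_8[of x] by simp
  show ?thesis
    unfolding True def2 x_def[symmetric] y_def[symmetric] z_def[symmetric] z
    using cases[of a, folded x_def] cases[of b, folded y_def]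
    by (elim disjE; clarify; simp)
next
  case False
  obtain q where q: "p = int q" "prime q"
    using assms prime_gt_0_int[OF assms] by (metis pos_int_cases prime_int_nat_transfer nat_int)
  hence "2 < q" using False prime_ge_2_nat[OF q(2)] by auto
  with q False show ?thesis
    by (simp only: kronecker_prime_def if_False Legendre_mult)
qed

lemma kronecker_prime_cong:
  assumes "[a = b] (mod p)" "p = 2 \<Longrightarrow> [a = b] (mod 8)"
  shows "kronecker_prime a p = kronecker_prime b p"
proof (cases "p = 2")
  case True
  hence *: "a mod 8 = b mod 8" using assms(2) unfolding Cong.cong_def by blast
  hence "even a \<longleftrightarrow> even b" using even_iff_even_mod_8 by metis
  thus ?thesis using True * by (simp add: kronecker_prime_def)
next
  case False
  thus ?thesis using assms Legendre_cong by (simp add: kronecker_prime_def)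
qed

lemma kronecker_prime_values: "kronecker_prime a p \<in> {-1, 0, 1}"
  by (auto simp: kronecker_prime_def Legendre_def)

lemma kronecker_prime_eq_0_iff: "kronecker_prime a p = 0 \<longleftrightarrow> p dvd a"
  by (auto simp: kronecker_prime_def Legendre_def cong_0_iff)

lemma kronecker_pos:
  assumes "n > 0"
  shows "kronecker a n = (\<Prod>p\<in>prime_factors n. kronecker_prime a p ^ multiplicity p n)"
  using assms by (simp add: kronecker_def)

text \<open>As a product over a multiset, the symbol is multiplicative in its lower argument by
  \<open>prime_factorization_mult\<close>, without any bookkeeping of multiplicities.\<close>

lemma kronecker_conv_prod_mset:
  assumes "n > 0"
  shows "kronecker a n = (\<Prod>p\<in>#prime_factorization n. kronecker_prime a p)"
proof -
  have "(\<Prod>p\<in>#prime_factorization n. kronecker_prime a p) =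
      (\<Prod>p\<in>prime_factors n. kronecker_prime a p ^ count (prime_factorization n) p)"
    by (rule image_prod_mset_multiplicity)
  also have "\<dots> = kronecker a n"
    unfolding kronecker_pos[OF assms]
    by (intro prod.cong refl) (simp add: count_prime_factorization_prime in_prime_factors_imp_prime)
  finally show ?thesis ..
qed

lemma kronecker_one_right [simp]: "kronecker a 1 = 1"
  by (simp add: kronecker_def)

lemma kronecker_mult_right:
  assumes "m > 0" "n > 0"
  shows "kronecker a (m * n) = kronecker a m * kronecker a n"
  using assms by (simp add: kronecker_conv_prod_mset prime_factorization_mult)

lemma kronecker_power_right:
  assumes "m > 0"
  shows "kronecker a (m ^ j) = kronecker a m ^ j"
  using assms by (induction j) (simp_all add: kronecker_mult_right)

lemma kronecker_prod_right:
  assumes "\<And>i. i \<in> I \<Longrightarrow> f i > 0"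
  shows "kronecker a (\<Prod>i\<in>I. f i) = (\<Prod>i\<in>I. kronecker a (f i))"
  using assms
  by (induction I rule: infinite_finite_induct) (simp_all add: kronecker_mult_right prod_pos)

lemma kronecker_mult_left:
  assumes "n > 0"
  shows "kronecker (a * b) n = kronecker a n * kronecker b n"
  using assms unfolding kronecker_pos[OF assms] prod.distrib[symmetric]
  by (intro prod.cong refl)
    (simp add: kronecker_prime_mult in_prime_factors_imp_prime power_mult_distrib)

text \<open>The symbol at 2 sees its upper argument modulo 8, while \<open>n\<close> may contain a
  single factor 2. Hence the extra hypothesis, and the period \<open>8 * n\<close> in all that
  follows.\<close>

lemma kronecker_cong:
  assumes "n > 0" "[a = b] (mod n)" "even n \<Longrightarrow> [a = b] (mod 8)"
  shows "kronecker a n = kronecker b n"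
  unfolding kronecker_pos[OF assms(1)]
proof (intro prod.cong refl)
  fix p assume p: "p \<in> prime_factors n"
  hence "p dvd n" by auto
  hence "kronecker_prime a p = kronecker_prime b p"
    using assms cong_dvd_modulus by (intro kronecker_prime_cong) blast+
  thus "kronecker_prime a p ^ multiplicity p n = kronecker_prime b p ^ multiplicity p n"
    by simp
qed

lemma kronecker_values:
  assumes "n > 0"
  shows "kronecker a n \<in> {-1, 0, 1}"
proof -
  have "(\<Prod>p\<in>#M. kronecker_prime a p) \<in> {-1, 0, 1}" for M
  proof (induction M)
    case (add p M)
    thus ?case using kronecker_prime_values[of a p] by auto
  qed auto
  thus ?thesis using assms by (simp only: kronecker_conv_prod_mset)
qed

lemma abs_kronecker_le_1:
  assumes "n > 0"
  shows "\<bar>kronecker a n\<bar> \<le> 1"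
  using kronecker_values[OF assms, of a] by auto

lemma kronecker_eq_0_iff:
  assumes "n > 0"
  shows "kronecker a n = 0 \<longleftrightarrow> \<not> coprime a n"
proof -
  have "kronecker a n = 0 \<longleftrightarrow> (\<exists>p\<in>prime_factors n. p dvd a)"
    using assms
    by (simp add: kronecker_pos prod_zero_iff kronecker_prime_eq_0_iff)
      (auto simp: prime_factors_multiplicity)
  also have "\<dots> \<longleftrightarrow> \<not> coprime a n"
  proof
    assume "\<exists>p\<in>prime_factors n. p dvd a"
    then obtain p where "prime p" "p dvd n" "p dvd a" by auto
    thus "\<not> coprime a n" by (metis coprime_common_divisor not_prime_unit)
  next
    assume "\<not> coprime a n"
    hence "gcd a n \<noteq> 1" "gcd a n \<noteq> 0" using assms by (auto simp: coprime_iff_gcd_eq_1)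
    then obtain p where "prime p" "p dvd gcd a n"
      by (metis abs_of_nonneg gcd_ge_0_int prime_factor_int)
    thus "\<exists>p\<in>prime_factors n. p dvd a" using assms by (auto simp: prime_factors_dvd)
  qed
  finally show ?thesis .
qed

text \<open>By multiplicativity the value is its own square, and by coprimality it is not 0.\<close>

lemma kronecker_one_left [simp]:
  assumes "n > 0"
  shows "kronecker 1 n = 1"
  using kronecker_mult_left[OF assms, of 1 1] kronecker_eq_0_iff[OF assms, of 1] by auto

lemma kronecker_square_right:
  assumes "n > 0" "is_square n"
  shows "kronecker a n = (if coprime a n then 1 else 0)"
proof -
  obtain z where z: "n = z ^ 2" using assms(2) by (auto elim: is_nth_powerE)
  have *: "n = \<bar>z\<bar> ^ 2" "\<bar>z\<bar> > 0" using z assms(1) by auto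
  have "kronecker a n = kronecker a \<bar>z\<bar> ^ 2"
    using * kronecker_power_right[of "\<bar>z\<bar>" a 2] by simp
  thus ?thesis
    using kronecker_values[OF *(2), of a] kronecker_eq_0_iff[OF assms(1), of a] by auto
qed

text \<open>Squaring modulo \<open>p\<close> takes the same value at 1 and at -1. A map of a finite
  set to itself that is not injective is not surjective either, and a missed residue is a
  nonresidue; it is not 0, because 0 is a square.\<close>

lemma ex_Legendre_eq_minus_1:
  assumes "prime p" "2 < p"
  obtains a where "Legendre a (int p) = -1"
proof -
  let ?f = "\<lambda>x::int. x ^ 2 mod int p" and ?S = "{0..<int p}"
  have "?f 1 = ?f (int p - 1)"
  proof -
    have "(int p - 1) ^ 2 = 1 + int p * (int p - 2)"
      by (simp add: power2_eq_square algebra_simps)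
    thus ?thesis by (metis mod_mult_self2 power_one)
  qed
  hence "\<not> inj_on ?f ?S"
    using assms(2) unfolding inj_on_def
    by (intro notI) (drule bspec[of _ _ 1], simp, drule bspec[of _ _ "int p - 1"], auto)
  moreover have "?f ` ?S \<subseteq> ?S" using assms by auto
  ultimately have "?f ` ?S \<noteq> ?S"
    using finite_surj_inj[of ?S ?f] by blast
  then obtain a where a: "a \<in> ?S" "a \<notin> ?f ` ?S"
    using \<open>?f ` ?S \<subseteq> ?S\<close> by blast
  have "\<not> QuadRes (int p) a"
  proof
    assume "QuadRes (int p) a"
    then obtain y where "[y ^ 2 = a] (mod int p)" by (auto simp: QuadRes_def)
    hence "?f (y mod int p) = a" using a(1) unfolding power_mod by (simp add: Cong.cong_def)
    moreover have "y mod int p \<in> ?S" using assms by simp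
    ultimately show False using a(2) by blast
  qed
  moreover have "\<not> [a = 0] (mod int p)"
  proof
    assume "[a = 0] (mod int p)"
    hence "a = 0" using a(1) by (simp add: Cong.cong_def)
    hence "a = ?f 0" "(0::int) \<in> ?S" using assms by simp_all
    thus False using a(2) by blast
  qed
  ultimately have "Legendre a (int p) = -1" by (simp add: Legendre_def)
  thus ?thesis by (rule that)
qed

text \<open>A nonsquare has a prime \<open>p\<close> of odd multiplicity. The Chinese remainder
  theorem gives a \<open>D\<close> whose symbol at \<open>p\<close> is -1 and which looks like 1
  everywhere else. The condition modulo 4 ensures that multiplication by \<open>D\<close> preserves
  the residue modulo 4, and with it the set of discriminants.\<close>

lemma ex_kronecker_eq_minus_1:
  assumes "n > 0" "\<not> is_square n"
  obtains D where "D mod 4 = 1" "kronecker D n = -1"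
proof -
  obtain p where p: "prime p" "odd (multiplicity p n)"
  proof -
    have "\<exists>p. prime p \<and> odd (multiplicity p n)"
    proof (rule ccontr)
      assume "\<nexists>p. prime p \<and> odd (multiplicity p n)"
      hence ev: "even (multiplicity p n)" if "prime p" for p using that by blast
      have "n = (\<Prod>p\<in>prime_factors n. p ^ multiplicity p n)"
        using assms(1) by (simp add: prod_prime_factors)
      also have "\<dots> = (\<Prod>p\<in>prime_factors n. (p ^ (multiplicity p n div 2)) ^ 2)"
        using ev by (intro prod.cong refl) (simp add: power_mult[symmetric] in_prime_factors_imp_prime)
      also have "\<dots> = (\<Prod>p\<in>prime_factors n. p ^ (multiplicity p n div 2)) ^ 2"
        by (simp add: prod_power_distrib)
      finally have "is_square n" by (metis is_nth_powerI)
      thus False using assms(2) by simp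
    qed
    thus ?thesis using that by blast
  qed
  define j where "j = multiplicity p n"
  obtain e where e: "n = p ^ j * e" "\<not> p dvd e"
    using multiplicity_decompose'[of n p] assms(1) p(1) not_prime_unit[of p] unfolding j_def by blast
  have p0: "p > 0" using p(1) by (rule prime_gt_0_int)
  have e0: "e > 0" using e(1) assms(1) p0 by (simp add: zero_less_mult_iff)
  have cop: "coprime p e" using p(1) e(2) by (simp add: prime_imp_coprime)
  have kp: "kronecker a p = kronecker_prime a p" for a
    using p(1) p0 by (simp add: kronecker_conv_prod_mset prime_factorization_prime)
  have n: "kronecker a n = kronecker_prime a p ^ j * kronecker a e" for a
    using e(1) p0 e0 by (simp add: kronecker_mult_right kronecker_power_right kp)
  show ?thesis
  proof (cases "p = 2")
    case True
    hence "coprime 8 e" using cop coprime_power_left_iff[of 2 3 e] by simp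
    \<comment> \<open>Among the residues modulo 8, 5 is the one that is 1 modulo 4 and has symbol -1
      at 2.\<close>
    then obtain D where D: "[D = 5] (mod 8)" "[D = 1] (mod e)"
      using binary_chinese_remainder_int by blast
    have "D mod 8 = 5" using D(1) by (simp add: Cong.cong_def)
    moreover from this have "D mod 4 = 1" "odd D"
      using mod_mod_cancel[of 4 8 D] even_iff_even_mod_8[of D] by simp_all
    moreover have "kronecker D e = kronecker 1 e"
      using D(2) e0 e(2) True by (intro kronecker_cong) auto
    ultimately show ?thesis
      using e0 p(2) True by (intro that[of D]) (simp_all add: n kronecker_prime_def j_def)
  next
    case False
    obtain q where q: "p = int q" "prime q"
      using p(1) p0 by (metis pos_int_cases prime_int_nat_transfer nat_int)
    hence "2 < q" using False prime_ge_2_nat[OF q(2)] by auto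
    then obtain a where a: "Legendre a p = -1" using ex_Legendre_eq_minus_1[OF q(2)] q(1) by blast
    have "coprime p 8"
      using False p(1) primes_coprime[of p 2] coprime_power_right_iff[of p 2 3] by simp
    hence "coprime p (8 * e)" using cop by simp
    then obtain D where D: "[D = a] (mod p)" "[D = 1] (mod 8 * e)"
      using binary_chinese_remainder_int by blast
    have D': "[D = 1] (mod 8)" "[D = 1] (mod e)"
      using D(2) by (auto intro: cong_dvd_modulus)
    hence "D mod 8 = 1" by (simp add: Cong.cong_def)
    hence "D mod 4 = 1" using mod_mod_cancel[of 4 8 D] by simp
    moreover have "kronecker D e = kronecker 1 e"
      using D' e0 by (intro kronecker_cong) auto
    moreover have "kronecker_prime D p = -1"
      using False a Legendre_cong[OF D(1)] by (simp add: kronecker_prime_def)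
    ultimately show ?thesis
      using e0 p(2) by (intro that[of D]) (simp_all add: n j_def)
  qed
qed

section \<open>Sums of the Kronecker symbol over its upper argument\<close>

text \<open>With g the gcd, \<open>totient_gcd\<close> equates
  \<open>totient a * totient b * g\<close> with \<open>totient (a * b) * totient g\<close>, and
  \<open>totient g\<close> is at most g.\<close>

lemma totient_mult_ge: "totient a * totient b \<le> totient (a * b)"
proof (cases "gcd a b = 0")
  case False
  have "totient a * totient b * gcd a b \<le> totient (a * b) * gcd a b"
    unfolding totient_gcd [symmetric] by (simp add: totient_le)
  thus ?thesis using False mult_le_cancel2 by blast
qed simp

text \<open>The reflection of x to \<open>8 * n - x\<close> exchanges the classes 1 and 3 modulo 4,
  so each holds half of the totatives of \<open>8 * n\<close>. These are discriminants coprime to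
  \<open>n\<close>; ignoring the even ones costs a constant factor.\<close>

lemma card_totatives_1_mod_4:
  assumes "n > 0"
  shows "2 * totient n \<le> card {x\<in>totatives (8 * n). x mod 4 = 1}"
proof -
  define T where "T = totatives (8 * n)"
  define A B where "A = {x\<in>T. x mod 4 = 1}" and "B = {x\<in>T. x mod 4 = 3}"
  have T: "x \<in> T \<longleftrightarrow> x > 0 \<and> x < 8 * n \<and> coprime x (8 * n)" for x
  proof -
    \<comment> \<open>\<open>totatives\<close> admits its upper endpoint; here it is excluded
      because \<open>8 * n\<close> is not coprime to itself.\<close>
    have "x \<noteq> 8 * n" if "coprime x (8 * n)"
      using that assms by (auto simp del: coprime_mult_right_iff coprime_mult_left_iff)
    thus ?thesis unfolding T_def in_totatives_iff by (auto simp: le_less)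
  qed
  have fin: "finite A" "finite B" by (simp_all add: A_def B_def T_def)
  have "bij_betw (\<lambda>x. 8 * n - x) A B"
  proof (rule bij_betwI[where g = "\<lambda>x. 8 * n - x"])
    have refl: "8 * n - x \<in> T" if "x \<in> T" for x
    proof -
      have x: "0 < x" "x < 8 * n" "coprime x (8 * n)" using that by (simp_all only: T)
      have "coprime (8 * n - x) (8 * n)"
      proof (rule coprimeI)
        fix d assume d: "d dvd 8 * n - x" "d dvd 8 * n"
        have "d dvd 8 * n - (8 * n - x)" using d by (rule dvd_diff_nat[rotated])
        hence "d dvd x" using x(2) by simp
        thus "is_unit d" using d(2) x(3) coprime_common_divisor by blast
      qed
      thus ?thesis using x by (simp only: T) simp
    qed
    have m: "(8 * n - x) mod 4 = 4 - x mod 4" if "x < 8 * n" "x mod 4 \<noteq> 0" for x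
    proof -
      have "x = 4 * (x div 4) + x mod 4" by simp
      moreover have "x mod 4 < 4" by simp
      ultimately have "8 * n - x = 4 - x mod 4 + 4 * (2 * n - x div 4 - 1)"
        using that by linarith
      hence "(8 * n - x) mod 4 = (4 - x mod 4) mod 4" by (simp only: mod_mult_self2)
      thus ?thesis using that(2) by simp
    qed
    show "(\<lambda>x. 8 * n - x) \<in> A \<rightarrow> B" "(\<lambda>x. 8 * n - x) \<in> B \<rightarrow> A"
      using refl m by (auto simp: A_def B_def T)
  qed (auto simp: A_def B_def T)
  hence "card A = card B" by (rule bij_betw_same_card)
  moreover have "T = A \<union> B"
  proof -
    have "x mod 4 = 1 \<or> x mod 4 = 3" if "x \<in> T" for x
    proof -
      have "odd x" using that by (auto simp: T)
      thus ?thesis by presburger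
    qed
    thus ?thesis by (auto simp: A_def B_def)
  qed
  moreover have "card (A \<union> B) = card A + card B"
    using fin by (intro card_Un_disjoint) (auto simp: A_def B_def)
  ultimately have "2 * card A = totient (8 * n)" by (simp add: T_def totient_def)
  moreover have "totient 8 = 4"
    using totient_prime_power[of 2 3] by simp
  ultimately show ?thesis
    using totient_mult_ge[of 8 n] by (simp add: A_def T_def)
qed

section \<open>Sums of periodic functions over intervals\<close>

lemma sum_period_shift:
  fixes f :: "int \<Rightarrow> real"
  assumes "M > 0" "\<And>x. f (x mod M) = f x"
  shows "(\<Sum>x\<in>{a..<a+M}. f x) = (\<Sum>x\<in>{0..<M}. f x)"
proof -
  have inj: "inj_on (\<lambda>x. x mod M) {a..<a+M}"
  proof (rule inj_onI)
    fix x y assume *: "x \<in> {a..<a+M}" "y \<in> {a..<a+M}" "x mod M = y mod M"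
    hence "M dvd x - y" by (simp add: mod_eq_dvd_iff)
    moreover have "\<bar>x - y\<bar> < M" using * by auto
    ultimately show "x = y" using dvd_imp_le_int[of "x - y" M] assms(1) by fastforce
  qed
  have "(\<lambda>x. x mod M) ` {a..<a+M} = {0..<M}"
    using inj assms(1) by (intro card_subset_eq) (auto simp: card_image)
  hence "bij_betw (\<lambda>x. x mod M) {a..<a+M} {0..<M}" using inj by (simp add: bij_betw_def)
  from sum.reindex_bij_betw[OF this, of f] show ?thesis by (simp add: assms(2))
qed

lemma sum_periods:
  fixes f :: "int \<Rightarrow> real"
  assumes "M > 0" "\<And>x. f (x mod M) = f x"
  shows "(\<Sum>x\<in>{a..<a + int t * M}. f x) = real t * (\<Sum>x\<in>{0..<M}. f x)"
proof (induction t)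
  case (Suc t)
  have "{a..<a + int (Suc t) * M} = {a..<a + int t * M} \<union> {a + int t * M..<(a + int t * M) + M}"
    using assms(1) by (auto simp: algebra_simps not_less; smt (verit) mult_nonneg_nonneg of_nat_0_le_iff)
  hence "(\<Sum>x\<in>{a..<a + int (Suc t) * M}. f x) =
      (\<Sum>x\<in>{a..<a + int t * M}. f x) + (\<Sum>x\<in>{a + int t * M..<(a + int t * M) + M}. f x)"
    by (simp only:) (rule sum.union_disjoint, auto)
  thus ?case using Suc.IH sum_period_shift[of M f "a + int t * M"] assms
    by (simp add: algebra_simps)
qed simp

text \<open>Extending by 0 to all integers turns sums over discriminants into sums of a periodic
  function over intervals. Perfect squares \<open>D\<close>, which \<open>quad_chars\<close> omits,
  are still present here.\<close>

definition disc_kronecker :: "nat \<Rightarrow> int \<Rightarrow> real" where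
  "disc_kronecker n D = (if D mod 4 \<in> {0, 1} then real_of_int (kronecker D (int n)) else 0)"

lemma disc_kronecker_mod:
  assumes "n > 0"
  shows "disc_kronecker n (D mod (8 * int n)) = disc_kronecker n D"
proof -
  have "[D mod (8 * int n) = D] (mod 8 * int n)" by (simp add: Cong.cong_def)
  hence "[D mod (8 * int n) = D] (mod int n)" "[D mod (8 * int n) = D] (mod 8)"
    by (rule cong_dvd_modulus, simp)+
  hence "kronecker (D mod (8 * int n)) (int n) = kronecker D (int n)"
    using assms by (intro kronecker_cong) auto
  moreover have "D mod (8 * int n) mod 4 = D mod 4" by (rule mod_mod_cancel) simp
  ultimately show ?thesis by (simp add: disc_kronecker_def)
qed

lemma abs_disc_kronecker_le_1:
  assumes "n > 0"
  shows "\<bar>disc_kronecker n D\<bar> \<le> 1"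
  using abs_kronecker_le_1[of "int n" D] assms by (auto simp: disc_kronecker_def)

lemma is_square_int_iff: "is_square (int n) \<longleftrightarrow> is_square n"
proof
  assume "is_square (int n)"
  then obtain z where "int n = z ^ 2" by (auto elim: is_nth_powerE)
  hence "int n = int (nat \<bar>z\<bar> ^ 2)" by simp
  thus "is_square n" by (metis is_nth_powerI of_nat_eq_iff)
next
  assume "is_square n"
  then obtain z where "n = z ^ 2" by (auto elim: is_nth_powerE)
  thus "is_square (int n)" by (intro is_nth_powerI[of _ "int z"]) simp
qed

text \<open>The usual orthogonality argument: multiplication by a suitable \<open>D0\<close>
  permutes the residues modulo \<open>8 * n\<close>, keeps the class modulo 4 and changes the sign
  of every term.\<close>

lemma sum_disc_kronecker_period_nonsquare:
  assumes "n > 0" "\<not> is_square n"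
  shows "(\<Sum>D\<in>{0..<8 * int n}. disc_kronecker n D) = 0"
proof -
  define M where "M = 8 * int n"
  have M: "M > 0" using assms(1) by (simp add: M_def)
  obtain D0 where D0: "D0 mod 4 = 1" "kronecker D0 (int n) = -1"
    using ex_kronecker_eq_minus_1[of "int n"] assms by (auto simp: is_square_int_iff)
  have "coprime D0 (int n)" using D0(2) kronecker_eq_0_iff[of "int n" D0] assms(1) by auto
  moreover have "coprime D0 (2 ^ 3)"
  proof -
    have "odd D0" using D0(1) by presburger
    thus ?thesis by (simp only: coprime_power_right_iff) (simp add: coprime_right_2_iff_odd)
  qed
  ultimately have cop: "coprime D0 M" by (simp add: M_def)
  have inj: "inj_on (\<lambda>x. x * D0 mod M) {0..<M}"
  proof (rule inj_onI)
    fix x y assume *: "x \<in> {0..<M}" "y \<in> {0..<M}" "x * D0 mod M = y * D0 mod M"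
    hence "M dvd (x - y) * D0" by (simp add: mod_eq_dvd_iff algebra_simps)
    hence "M dvd x - y" using cop by (simp add: coprime_dvd_mult_left_iff coprime_commute)
    moreover have "\<bar>x - y\<bar> < M" using * by auto
    ultimately show "x = y" using dvd_imp_le_int[of "x - y" M] M by fastforce
  qed
  have "(\<lambda>x. x * D0 mod M) ` {0..<M} = {0..<M}"
    using inj M by (intro card_subset_eq) (auto simp: card_image)
  hence bij: "bij_betw (\<lambda>x. x * D0 mod M) {0..<M} {0..<M}" using inj by (simp add: bij_betw_def)
  have "(\<Sum>D\<in>{0..<M}. disc_kronecker n D) = (\<Sum>D\<in>{0..<M}. disc_kronecker n (D * D0 mod M))"
    by (rule sum.reindex_bij_betw[OF bij, symmetric])
  also have "\<dots> = (\<Sum>D\<in>{0..<M}. - disc_kronecker n D)"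
  proof (intro sum.cong refl)
    fix D
    have "disc_kronecker n (D * D0 mod M) = disc_kronecker n (D * D0)"
      unfolding M_def by (rule disc_kronecker_mod) fact
    also have "\<dots> = - disc_kronecker n D"
    proof -
      have "D * D0 mod 4 = D mod 4" using D0(1) by (metis mod_mult_right_eq mult.right_neutral)
      thus ?thesis using assms(1) D0(2) by (simp add: disc_kronecker_def kronecker_mult_left)
    qed
    finally show "disc_kronecker n (D * D0 mod M) = - disc_kronecker n D" .
  qed
  also have "\<dots> = - (\<Sum>D\<in>{0..<M}. disc_kronecker n D)" by (rule sum_negf)
  finally show ?thesis by (simp add: M_def)
qed

text \<open>Whole periods are cut off from the left end and \<open>S\<close> is what remains. The
  first conclusion bounds the number of periods from below, as the square case requires.\<close>

lemma sum_interval_split_periods: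
  assumes "n > 0"
  obtains t :: nat and S :: "int set" where
    "real (2 * N + 1) \<le> 8 * real n * (real t + 1)" "finite S" "card S \<le> 8 * n"
    "(\<Sum>D\<in>{- int N..int N}. disc_kronecker n D) =
       real t * (\<Sum>D\<in>{0..<8 * int n}. disc_kronecker n D) + (\<Sum>D\<in>S. disc_kronecker n D)"
proof -
  define t where "t = (2 * N + 1) div (8 * n)"
  define S where "S = {- int N + int t * (8 * int n)..<int N + 1}"
  have div: "2 * N + 1 = t * (8 * n) + (2 * N + 1) mod (8 * n)"
    unfolding t_def by (rule div_mult_mod_eq[symmetric])
  have less: "(2 * N + 1) mod (8 * n) < 8 * n" using assms by simp
  have le: "t * (8 * n) \<le> 2 * N + 1" "2 * N + 1 \<le> t * (8 * n) + 8 * n" using div less by linarith+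
  have le': "int t * (8 * int n) \<le> 2 * int N + 1"
    using le(1) by (metis (mono_tags) of_nat_le_iff of_nat_mult of_nat_add of_nat_1 of_nat_numeral)
  have "real (2 * N + 1) \<le> real (t * (8 * n) + 8 * n)" using le(2) by (simp only: of_nat_le_iff)
  hence 1: "real (2 * N + 1) \<le> 8 * real n * (real t + 1)" by (simp add: algebra_simps)
  have "int (card S) = 2 * int N + 1 - int t * (8 * int n)" using le' by (simp add: S_def)
  moreover have "2 * int N + 1 \<le> int t * (8 * int n) + 8 * int n"
    using le(2) by (metis (mono_tags) of_nat_le_iff of_nat_mult of_nat_add of_nat_1 of_nat_numeral)
  ultimately have 2: "card S \<le> 8 * n" by linarith
  have "{- int N..int N} = {- int N..<- int N + int t * (8 * int n)} \<union> S"
  proof -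
    have split: "{a..b} = {a..<a + q} \<union> {a + q..<b + 1}" if "0 \<le> q" "q \<le> b + 1 - a" for a b q :: int
      using that by auto
    show ?thesis unfolding S_def using le' by (intro split) auto
  qed
  hence "(\<Sum>D\<in>{- int N..int N}. disc_kronecker n D) =
      (\<Sum>D\<in>{- int N..<- int N + int t * (8 * int n)}. disc_kronecker n D) + (\<Sum>D\<in>S. disc_kronecker n D)"
    by (simp only:) (rule sum.union_disjoint, auto simp: S_def)
  also have "(\<Sum>D\<in>{- int N..<- int N + int t * (8 * int n)}. disc_kronecker n D) =
      real t * (\<Sum>D\<in>{0..<8 * int n}. disc_kronecker n D)"
    using assms by (intro sum_periods disc_kronecker_mod) auto
  finally show ?thesis using that[OF 1 _ 2] by (simp add: S_def)
qed

lemma sum_disc_kronecker_nonsquare: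
  assumes "n > 0" "\<not> is_square n"
  shows "\<bar>\<Sum>D\<in>{- int N..int N}. disc_kronecker n D\<bar> \<le> 8 * real n"
proof -
  obtain t S where *: "finite S" "card S \<le> 8 * n"
    "(\<Sum>D\<in>{- int N..int N}. disc_kronecker n D) =
       real t * (\<Sum>D\<in>{0..<8 * int n}. disc_kronecker n D) + (\<Sum>D\<in>S. disc_kronecker n D)"
    using sum_interval_split_periods[OF assms(1), of N] by metis
  have "\<bar>\<Sum>D\<in>{- int N..int N}. disc_kronecker n D\<bar> = \<bar>\<Sum>D\<in>S. disc_kronecker n D\<bar>"
    unfolding *(3) sum_disc_kronecker_period_nonsquare[OF assms] by simp
  also have "\<dots> \<le> (\<Sum>D\<in>S. \<bar>disc_kronecker n D\<bar>)" by (rule sum_abs)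
  also have "\<dots> \<le> (\<Sum>D\<in>S. 1)" using assms(1) by (intro sum_mono abs_disc_kronecker_le_1)
  also have "\<dots> \<le> 8 * real n" using *(2) by simp
  finally show ?thesis .
qed

lemma disc_kronecker_square:
  assumes "n > 0" "is_square n"
  shows "disc_kronecker n D = (if D mod 4 \<in> {0, 1} \<and> coprime D (int n) then 1 else 0)"
  using assms by (simp add: disc_kronecker_def kronecker_square_right is_square_int_iff)

text \<open>The terms are nonnegative, so the incomplete period may be dropped. A full period of
  length \<open>8 * n\<close> contributes at least \<open>2 * totient n\<close>, whence the factor
  1/4; losing one period costs \<open>2 * totient n\<close>, which is below
  \<open>8 * n\<close>.\<close>

lemma sum_disc_kronecker_square:
  assumes "n > 0" "is_square n"
  shows "real (2 * N + 1) * (real (totient n) / real n) / 4 - 8 * real n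
           \<le> (\<Sum>D\<in>{- int N..int N}. disc_kronecker n D)"
proof -
  define P where "P = (\<Sum>D\<in>{0..<8 * int n}. disc_kronecker n D)"
  obtain t S where *: "real (2 * N + 1) \<le> 8 * real n * (real t + 1)" "finite S"
    "(\<Sum>D\<in>{- int N..int N}. disc_kronecker n D) = real t * P + (\<Sum>D\<in>S. disc_kronecker n D)"
    using sum_interval_split_periods[OF assms(1), of N] unfolding P_def by metis
  have nonneg: "disc_kronecker n D \<ge> 0" for D using assms by (simp add: disc_kronecker_square)
  have P_ge: "P \<ge> 2 * real (totient n)"
  proof -
    define A where "A = {x\<in>totatives (8 * n). x mod 4 = 1}"
    have A_less: "int x < 8 * int n" if "x \<in> A" for x
      using that assms(1) totatives_less[of x "8 * n"] by (auto simp: A_def)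
    have "2 * real (totient n) \<le> real (card A)"
      using card_totatives_1_mod_4[OF assms(1)] unfolding A_def by linarith
    also have "card A = card (int ` A)" by (simp add: card_image)
    also have "real (card (int ` A)) = (\<Sum>D\<in>int ` A. disc_kronecker n D)"
    proof -
      have "disc_kronecker n D = 1" if D: "D \<in> int ` A" for D
      proof -
        obtain x where x: "D = int x" "x \<in> A" using D by blast
        have x': "x mod 4 = 1" "coprime x (8 * n)" using x(2) unfolding A_def in_totatives_iff by blast+
        hence "D mod 4 = 1" using x(1) by (metis of_nat_1 of_nat_numeral zmod_int)
        moreover have "coprime D (int n)" using x(1) x'(2) by simp
        ultimately show ?thesis using assms by (simp add: disc_kronecker_square)
      qed
      thus ?thesis by simp
    qed
    also have "\<dots> \<le> P"
      unfolding P_def using nonneg A_less by (intro sum_mono2) auto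
    finally show ?thesis .
  qed
  have "real (2 * N + 1) * (real (totient n) / real n) / 4 - 8 * real n \<le>
      8 * real n * (real t + 1) * (real (totient n) / real n) / 4 - 2 * real (totient n)"
  proof -
    have "real (totient n) \<le> real n" by (simp add: totient_le)
    moreover have "real (2 * N + 1) * (real (totient n) / real n) / 4 \<le>
        8 * real n * (real t + 1) * (real (totient n) / real n) / 4"
      using *(1) by (intro divide_right_mono mult_right_mono) auto
    ultimately show ?thesis by linarith
  qed
  also have "\<dots> = real t * (2 * real (totient n))" using assms(1) by (simp add: field_simps)
  also have "\<dots> \<le> real t * P" using P_ge by (intro mult_left_mono) auto
  also have "\<dots> \<le> (\<Sum>D\<in>{- int N..int N}. disc_kronecker n D)"
    unfolding *(3) using nonneg by (simp add: sum_nonneg)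
  finally show ?thesis .
qed

section \<open>Expanding the moment\<close>

lemma quad_chars_conv:
  assumes "X \<ge> 0"
  shows "quad_chars X = {D \<in> {- int (nat \<lfloor>X\<rfloor>)..int (nat \<lfloor>X\<rfloor>)}. \<not> is_square D \<and> D mod 4 \<in> {0, 1}}"
proof -
  have "real_of_int \<bar>D\<bar> \<le> X \<longleftrightarrow> D \<in> {- int (nat \<lfloor>X\<rfloor>)..int (nat \<lfloor>X\<rfloor>)}" for D
  proof -
    have "real_of_int \<bar>D\<bar> \<le> X \<longleftrightarrow> \<bar>D\<bar> \<le> \<lfloor>X\<rfloor>" by (rule le_floor_iff[symmetric])
    thus ?thesis using assms by (simp add: abs_le_iff) linarith
  qed
  thus ?thesis unfolding quad_chars_def by blast
qed

lemma card_quad_chars_le: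
  assumes "X \<ge> 0"
  shows "card (quad_chars X) \<le> 2 * nat \<lfloor>X\<rfloor> + 1"
proof -
  have "card (quad_chars X) \<le> card {- int (nat \<lfloor>X\<rfloor>)..int (nat \<lfloor>X\<rfloor>)}"
    unfolding quad_chars_conv[OF assms] by (intro card_mono) auto
  also have "\<dots> = nat (2 * int (nat \<lfloor>X\<rfloor>) + 1)" by simp
  finally show ?thesis by linarith
qed

text \<open>The roots can be taken from 0 to the integer part of \<open>sqrt N\<close>; the
  \<open>+ 1\<close> accounts for 0.\<close>

lemma card_squares_le:
  "real (card {D \<in> {- int N..int N}. is_square D}) \<le> sqrt N + 1"
proof -
  have "{D \<in> {- int N..int N}. is_square D} \<subseteq> (\<lambda>z. int z ^ 2) ` {..nat \<lfloor>sqrt N\<rfloor>}"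
  proof
    fix D assume D: "D \<in> {D \<in> {- int N..int N}. is_square D}"
    then obtain z where z: "D = z ^ 2" by (auto elim: is_nth_powerE)
    have "z ^ 2 \<le> int N" using D z by auto
    hence "int (nat \<bar>z\<bar> ^ 2) \<le> int N" by simp
    hence "real (nat \<bar>z\<bar> ^ 2) \<le> real N" by (simp only: of_nat_le_iff)
    hence "real (nat \<bar>z\<bar>) \<le> sqrt N" by (intro real_le_rsqrt) simp
    hence "nat \<bar>z\<bar> \<le> nat \<lfloor>sqrt N\<rfloor>" by (simp add: le_nat_floor)
    thus "D \<in> (\<lambda>z. int z ^ 2) ` {..nat \<lfloor>sqrt N\<rfloor>}"
      using z by (intro image_eqI[of _ _ "nat \<bar>z\<bar>"]) auto
  qed
  hence "card {D \<in> {- int N..int N}. is_square D} \<le> card ((\<lambda>z. int z ^ 2) ` {..nat \<lfloor>sqrt N\<rfloor>})"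
    by (intro card_mono) auto
  also have "\<dots> \<le> card {..nat \<lfloor>sqrt N\<rfloor>}" by (rule card_image_le) simp
  also have "\<dots> = nat \<lfloor>sqrt N\<rfloor> + 1" by simp
  finally have "real (card {D \<in> {- int N..int N}. is_square D}) \<le> real (nat \<lfloor>sqrt N\<rfloor>) + 1" by linarith
  moreover have "real (nat \<lfloor>sqrt N\<rfloor>) \<le> sqrt N" by simp
  ultimately show ?thesis by linarith
qed

text \<open>The two sums differ exactly by the perfect squares \<open>D\<close>, each of which
  contributes at most 1 in absolute value.\<close>

lemma sum_quad_chars_approx:
  assumes "X \<ge> 0" "n > 0"
  defines "N \<equiv> nat \<lfloor>X\<rfloor>"
  shows "\<bar>(\<Sum>D\<in>quad_chars X. real_of_int (kronecker D (int n))) -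
            (\<Sum>D\<in>{- int N..int N}. disc_kronecker n D)\<bar> \<le> sqrt N + 1"
proof -
  define I where "I = {- int N..int N}"
  define Sq where "Sq = {D \<in> I. is_square D}"
  have fin: "finite I" by (simp add: I_def)
  have fin': "finite Sq" using fin by (rule finite_subset[rotated]) (auto simp: Sq_def)
  have "(\<Sum>D\<in>quad_chars X. real_of_int (kronecker D (int n))) = (\<Sum>D\<in>I - Sq. disc_kronecker n D)"
    using fin fin' unfolding quad_chars_conv[OF assms(1)] N_def[symmetric]
    by (intro sum.mono_neutral_cong_left) (auto simp: Sq_def disc_kronecker_def I_def)
  also have "\<dots> = (\<Sum>D\<in>I. disc_kronecker n D) - (\<Sum>D\<in>Sq. disc_kronecker n D)"
    using fin fin' by (intro sum_diff) (auto simp: Sq_def)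
  finally have "\<bar>(\<Sum>D\<in>quad_chars X. real_of_int (kronecker D (int n))) - (\<Sum>D\<in>I. disc_kronecker n D)\<bar> =
      \<bar>\<Sum>D\<in>Sq. disc_kronecker n D\<bar>" by simp
  also have "\<dots> \<le> (\<Sum>D\<in>Sq. \<bar>disc_kronecker n D\<bar>)" by (rule sum_abs)
  also have "\<dots> \<le> (\<Sum>D\<in>Sq. 1)" using assms(2) by (intro sum_mono abs_disc_kronecker_le_1)
  also have "\<dots> \<le> sqrt N + 1" using card_squares_le[of N] by (simp add: Sq_def I_def)
  finally show ?thesis by (simp add: I_def)
qed

section \<open>The moment as a sum over tuples\<close>

definition tuples :: "nat \<Rightarrow> nat \<Rightarrow> (nat \<Rightarrow> nat) set" where
  "tuples r y = PiE {..<r} (\<lambda>_. {1..y})"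

definition square_tuples :: "nat \<Rightarrow> nat \<Rightarrow> (nat \<Rightarrow> nat) set" where
  "square_tuples r y = {v \<in> tuples r y. is_square (\<Prod>i<r. v i)}"

lemma finite_tuples: "finite (tuples r y)"
  by (auto simp: tuples_def intro: finite_PiE)

lemma card_tuples: "card (tuples r y) = y ^ r"
  by (simp add: tuples_def card_PiE)

lemma tuples_prod:
  assumes "v \<in> tuples r y"
  shows "(\<Prod>i<r. v i) > 0" "(\<Prod>i<r. v i) \<le> y ^ r"
proof -
  have v: "v i \<in> {1..y}" if "i < r" for i using assms that by (auto simp: tuples_def PiE_iff)
  show "(\<Prod>i<r. v i) > 0" using v by (intro prod_pos) (auto simp: Suc_le_eq)
  have "(\<Prod>i<r. v i) \<le> (\<Prod>i<r. y)" using v by (intro prod_mono) auto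
  thus "(\<Prod>i<r. v i) \<le> y ^ r" by simp
qed

text \<open>The exponent is even, so the absolute value disappears and the power is a product of
  \<open>2 * k\<close> equal sums. Multiplicativity in the lower argument then merges each tuple
  into a single symbol.\<close>

lemma char_moment_expand:
  "char_moment k X Y = (\<Sum>v\<in>tuples (2 * k) (nat \<lfloor>Y\<rfloor>).
     \<Sum>D\<in>quad_chars X. real_of_int (kronecker D (int (\<Prod>i<2*k. v i))))"
proof -
  define y where "y = nat \<lfloor>Y\<rfloor>"
  have "\<bar>\<Sum>n\<in>{1..\<lfloor>Y\<rfloor>}. real_of_int (kronecker D n)\<bar> ^ (2 * k) =
      (\<Sum>v\<in>tuples (2 * k) y. real_of_int (kronecker D (int (\<Prod>i<2*k. v i))))" for D
  proof -
    have "{1..\<lfloor>Y\<rfloor>} = int ` {1..y}"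
    proof (intro equalityI subsetI)
      fix x assume "x \<in> {1..\<lfloor>Y\<rfloor>}"
      thus "x \<in> int ` {1..y}" unfolding y_def by (intro image_eqI[of _ _ "nat x"]) auto
    qed (auto simp: y_def)
    hence "(\<Sum>n\<in>{1..\<lfloor>Y\<rfloor>}. real_of_int (kronecker D n)) =
        (\<Sum>n\<in>{1..y}. real_of_int (kronecker D (int n)))"
      by (simp add: sum.reindex)
    hence "\<bar>\<Sum>n\<in>{1..\<lfloor>Y\<rfloor>}. real_of_int (kronecker D n)\<bar> ^ (2 * k) =
        (\<Prod>i<2*k. \<Sum>n\<in>{1..y}. real_of_int (kronecker D (int n)))"
      by (simp add: power_even_abs)
    also have "\<dots> = (\<Sum>v\<in>tuples (2 * k) y. \<Prod>i<2*k. real_of_int (kronecker D (int (v i))))"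
      unfolding tuples_def by (rule prod_sum_PiE) auto
    also have "\<dots> = (\<Sum>v\<in>tuples (2 * k) y. real_of_int (kronecker D (int (\<Prod>i<2*k. v i))))"
    proof (intro sum.cong refl)
      fix v assume "v \<in> tuples (2 * k) y"
      hence "int (v i) > 0" if "i \<in> {..<2*k}" for i
        using that by (force simp: tuples_def PiE_iff)
      hence "kronecker D (\<Prod>i<2*k. int (v i)) = (\<Prod>i<2*k. kronecker D (int (v i)))"
        by (rule kronecker_prod_right)
      thus "(\<Prod>i<2*k. real_of_int (kronecker D (int (v i)))) =
          real_of_int (kronecker D (int (\<Prod>i<2*k. v i)))"
        by simp
    qed
    finally show ?thesis .
  qed
  hence "char_moment k X Y = (\<Sum>D\<in>quad_chars X. \<Sum>v\<in>tuples (2 * k) y.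
      real_of_int (kronecker D (int (\<Prod>i<2*k. v i))))"
    by (simp add: char_moment_def)
  thus ?thesis unfolding y_def by (simp only: sum.swap[of _ "quad_chars X"])
qed

text \<open>\<open>E\<close> bounds the error of a single tuple: its first term is
  \<open>8 * m\<close> with \<open>m\<close> at most \<open>y ^ (2 * k)\<close>, the rest comes from
  the perfect squares \<open>D\<close>. It is charged once for each of the
  \<open>y ^ (2 * k)\<close> tuples.\<close>

lemma char_moment_bounds:
  fixes k :: nat and X Y :: real
  assumes "X \<ge> 0"
  defines "N \<equiv> nat \<lfloor>X\<rfloor>" and "y \<equiv> nat \<lfloor>Y\<rfloor>"
  defines "E \<equiv> 8 * real y ^ (2 * k) + sqrt N + 1"
  shows "char_moment k X Y \<le> (2 * real N + 1) * card (square_tuples (2 * k) y) + real y ^ (2 * k) * E"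
    and "char_moment k X Y \<ge> (2 * real N + 1) / 4 *
           (\<Sum>v\<in>square_tuples (2 * k) y. real (totient (\<Prod>i<2*k. v i)) / real (\<Prod>i<2*k. v i)) -
           real y ^ (2 * k) * E"
proof -
  define V S where "V = tuples (2 * k) y" and "S = square_tuples (2 * k) y"
  define m where "m v = (\<Prod>i<2*k. v i)" for v :: "nat \<Rightarrow> nat"
  define g where "g v = (\<Sum>D\<in>quad_chars X. real_of_int (kronecker D (int (m v))))" for v
  have fin: "finite V" by (simp add: V_def finite_tuples)
  have SV: "S \<subseteq> V" by (auto simp: S_def V_def square_tuples_def)
  have finS: "finite S" using SV fin by (rule finite_subset)
  have m_pos: "m v > 0" and m_le: "real (m v) \<le> real y ^ (2 * k)" if "v \<in> V" for v
  proof -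
    show "m v > 0" using tuples_prod[of v "2 * k" y] that by (simp add: m_def V_def)
    have "m v \<le> y ^ (2 * k)" using tuples_prod[of v "2 * k" y] that by (simp only: m_def V_def)
    thus "real (m v) \<le> real y ^ (2 * k)" by (metis of_nat_le_iff of_nat_power)
  qed
  have approx: "\<bar>g v - (\<Sum>D\<in>{- int N..int N}. disc_kronecker (m v) D)\<bar> \<le> sqrt N + 1" if "v \<in> V" for v
    using sum_quad_chars_approx[OF assms(1) m_pos[OF that]] unfolding N_def g_def .
  have E: "E \<ge> 0" by (simp add: E_def)
  have cardV: "real (card (V - S)) \<le> real y ^ (2 * k)" "real (card S) \<le> real y ^ (2 * k)"
       "card (V - S) + card S = y ^ (2 * k)"
  proof -
    have *: "card V = y ^ (2 * k)" by (simp add: V_def card_tuples)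
    have "card (V - S) \<le> card V" "card S \<le> card V" using fin SV by (auto intro: card_mono)
    thus "real (card (V - S)) \<le> real y ^ (2 * k)" "real (card S) \<le> real y ^ (2 * k)"
      unfolding * by (metis of_nat_le_iff of_nat_power)+
    show "card (V - S) + card S = y ^ (2 * k)"
      using * card_Diff_subset[OF finS SV] card_mono[OF fin SV] by simp
  qed
  have moment: "char_moment k X Y = (\<Sum>v\<in>V - S. g v) + (\<Sum>v\<in>S. g v)"
    unfolding char_moment_expand y_def[symmetric] V_def[symmetric] m_def[symmetric] g_def[symmetric]
    using fin SV by (rule sum.subset_diff[rotated])
  have off: "\<bar>g v\<bar> \<le> E" if "v \<in> V - S" for v
  proof -
    have "\<not> is_square (m v)" using that by (simp add: S_def V_def square_tuples_def m_def)
    hence "\<bar>\<Sum>D\<in>{- int N..int N}. disc_kronecker (m v) D\<bar> \<le> 8 * real (m v)"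
      using that m_pos by (intro sum_disc_kronecker_nonsquare) auto
    moreover have "v \<in> V" using that by blast
    ultimately show ?thesis using approx[of v] m_le[of v] unfolding E_def by linarith
  qed
  have off_sum: "\<bar>\<Sum>v\<in>V - S. g v\<bar> \<le> real (card (V - S)) * E"
  proof -
    have "\<bar>\<Sum>v\<in>V - S. g v\<bar> \<le> (\<Sum>v\<in>V - S. \<bar>g v\<bar>)" by (rule sum_abs)
    also have "\<dots> \<le> (\<Sum>v\<in>V - S. E)" by (intro sum_mono off)
    finally show ?thesis by simp
  qed
  \<comment> \<open>For the upper bound the number of characters suffices; the weight totient(m)/m,
    which this throws away, affects only the constant.\<close>
  have up: "g v \<le> 2 * real N + 1" if "v \<in> S" for v
  proof -
    have "m v > 0" using that SV m_pos by auto
    hence "g v \<le> (\<Sum>D\<in>quad_chars X. 1)" unfolding g_def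
      using abs_kronecker_le_1[of "int (m v)"] by (intro sum_mono) (force simp: abs_le_iff)
    also have "\<dots> = real (card (quad_chars X))" by simp
    also have "\<dots> \<le> 2 * real N + 1" using card_quad_chars_le[OF assms(1)] unfolding N_def by linarith
    finally show ?thesis .
  qed
  have "(\<Sum>v\<in>S. g v) \<le> (\<Sum>v\<in>S. 2 * real N + 1)" by (intro sum_mono up)
  also have "\<dots> = (2 * real N + 1) * card S" by simp
  finally have "(\<Sum>v\<in>S. g v) \<le> (2 * real N + 1) * card S" .
  moreover have "real (card (V - S)) * E \<le> real y ^ (2 * k) * E"
    using cardV E by (intro mult_right_mono) auto
  ultimately show "char_moment k X Y \<le>
      (2 * real N + 1) * card (square_tuples (2 * k) y) + real y ^ (2 * k) * E"
    using moment off_sum unfolding S_def by linarith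
  have low: "(2 * real N + 1) / 4 * (real (totient (m v)) / real (m v)) - E \<le> g v" if "v \<in> S" for v
  proof -
    have "is_square (m v)" using that by (simp add: S_def square_tuples_def m_def)
    hence "real (2 * N + 1) * (real (totient (m v)) / real (m v)) / 4 - 8 * real (m v)
           \<le> (\<Sum>D\<in>{- int N..int N}. disc_kronecker (m v) D)"
      using that SV m_pos by (intro sum_disc_kronecker_square) auto
    moreover have "\<bar>g v - (\<Sum>D\<in>{- int N..int N}. disc_kronecker (m v) D)\<bar> \<le> sqrt N + 1"
      "real (m v) \<le> real y ^ (2 * k)"
      using that SV by (blast intro: approx m_le)+
    moreover have "real (2 * N + 1) * (real (totient (m v)) / real (m v)) / 4 =
        (2 * real N + 1) / 4 * (real (totient (m v)) / real (m v))" by (simp add: mult.commute add.commute)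
    ultimately show ?thesis unfolding E_def by linarith
  qed
  have "(2 * real N + 1) / 4 * (\<Sum>v\<in>S. real (totient (m v)) / real (m v)) - real (card S) * E =
     (\<Sum>v\<in>S. (2 * real N + 1) / 4 * (real (totient (m v)) / real (m v)) - E)"
    by (simp add: sum_subtractf sum_distrib_left)
  also have "\<dots> \<le> (\<Sum>v\<in>S. g v)" by (intro sum_mono low)
  finally have "(2 * real N + 1) / 4 * (\<Sum>v\<in>S. real (totient (m v)) / real (m v)) - real (card S) * E
     \<le> (\<Sum>v\<in>S. g v)" .
  moreover have "real (card (V - S)) * E + real (card S) * E = real y ^ (2 * k) * E"
    unfolding distrib_right[symmetric] using cardV(3) by (metis of_nat_add of_nat_power)
  ultimately show "char_moment k X Y \<ge> (2 * real N + 1) / 4 *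
           (\<Sum>v\<in>square_tuples (2 * k) y. real (totient (\<Prod>i<2*k. v i)) / real (\<Prod>i<2*k. v i)) -
           real y ^ (2 * k) * E"
    using moment off_sum unfolding S_def m_def by linarith
qed

section \<open>Tuples whose product is a square\<close>

definition pairs_of :: "'a set \<Rightarrow> 'a set set" where
  "pairs_of I = {q. q \<subseteq> I \<and> card q = 2}"

lemma finite_pairs_of: "finite I \<Longrightarrow> finite (pairs_of I)"
  by (rule finite_subset[of _ "Pow I"]) (auto simp: pairs_of_def)

lemma card_pairs_of: "finite I \<Longrightarrow> card (pairs_of I) = card I choose 2"
  unfolding pairs_of_def by (rule n_subsets)

text \<open>The product of row i of a symmetric matrix without its diagonal. Indexing the entries by
  two-element sets builds in the symmetry; diagonal contributions belong to the square
  factors.\<close>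

definition pair_prod :: "'a set \<Rightarrow> ('a set \<Rightarrow> nat) \<Rightarrow> 'a \<Rightarrow> nat" where
  "pair_prod I a i = (\<Prod>q | q \<in> pairs_of I \<and> i \<in> q. a q)"

text \<open>Every entry \<open>a q\<close> occurs in exactly two rows, those of the two elements of
  \<open>q\<close>.\<close>

lemma prod_pair_prod:
  assumes "finite I"
  shows "(\<Prod>i\<in>I. pair_prod I a i) = (\<Prod>q\<in>pairs_of I. a q) ^ 2"
proof -
  have fin: "finite (pairs_of I)" using assms by (rule finite_pairs_of)
  have "(\<Prod>i\<in>I. pair_prod I a i) = (\<Prod>i\<in>I. \<Prod>q\<in>pairs_of I. if i \<in> q then a q else 1)"
    unfolding pair_prod_def using fin by (intro prod.cong refl prod.inter_filter)
  also have "\<dots> = (\<Prod>q\<in>pairs_of I. \<Prod>i\<in>I. if i \<in> q then a q else 1)"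
    by (rule prod.swap)
  also have "\<dots> = (\<Prod>q\<in>pairs_of I. a q ^ 2)"
  proof (intro prod.cong refl)
    fix q assume "q \<in> pairs_of I"
    hence "q \<subseteq> I" "card q = 2" by (auto simp: pairs_of_def)
    have "(\<Prod>i\<in>I. if i \<in> q then a q else 1) = (\<Prod>i\<in>I \<inter> {i. i \<in> q}. a q)"
      using assms by (simp add: prod.If_cases)
    also have "I \<inter> {i. i \<in> q} = q" using \<open>q \<subseteq> I\<close> by auto
    finally show "(\<Prod>i\<in>I. if i \<in> q then a q else 1) = a q ^ 2" using \<open>card q = 2\<close> by simp
  qed
  also have "\<dots> = (\<Prod>q\<in>pairs_of I. a q) ^ 2" by (rule prod_power_distrib[symmetric])
  finally show ?thesis .
qed

lemma pairs_of_insert_containing_new: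
  assumes "x \<notin> I"
  shows "{q. q \<in> pairs_of (insert x I) \<and> x \<in> q} = (\<lambda>i. {x, i}) ` I"
proof (intro equalityI subsetI)
  fix q assume "q \<in> {q. q \<in> pairs_of (insert x I) \<and> x \<in> q}"
  hence q: "q \<subseteq> insert x I" "card q = 2" "x \<in> q" by (auto simp: pairs_of_def)
  then obtain u v where "q = {u, v}" "u \<noteq> v" by (auto simp: card_2_iff)
  then obtain i where "q = {x, i}" "i \<noteq> x" using q(3) by (cases "u = x") auto
  thus "q \<in> (\<lambda>i. {x, i}) ` I" using q(1) by auto
qed (use assms in \<open>auto simp: pairs_of_def card_2_iff\<close>)

lemma pairs_of_insert_containing_old:
  assumes "x \<notin> I" "i \<in> I"
  shows "{q. q \<in> pairs_of (insert x I) \<and> i \<in> q} = insert {x, i} {q. q \<in> pairs_of I \<and> i \<in> q}"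
proof (intro equalityI subsetI)
  fix q assume "q \<in> {q. q \<in> pairs_of (insert x I) \<and> i \<in> q}"
  hence q: "q \<subseteq> insert x I" "card q = 2" "i \<in> q" by (auto simp: pairs_of_def)
  then obtain u v where "q = {u, v}" "u \<noteq> v" by (auto simp: card_2_iff)
  then obtain j where "q = {i, j}" "i \<noteq> j" using q(3) by (cases "u = i") auto
  thus "q \<in> insert {x, i} {q. q \<in> pairs_of I \<and> i \<in> q}"
    using q assms by (cases "j = x") (auto simp: pairs_of_def)
next
  fix q assume "q \<in> insert {x, i} {q. q \<in> pairs_of I \<and> i \<in> q}"
  moreover have "card {x, i} = 2" using assms by (subst card_2_iff) blast
  ultimately show "q \<in> {q. q \<in> pairs_of (insert x I) \<and> i \<in> q}"
    using assms by (auto simp: pairs_of_def)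
qed

text \<open>Induction on the two-factor case \<open>dvd_productE\<close>. It distributes the
  squarefree part of a new component over the old ones.\<close>

lemma dvd_prod_split:
  fixes s :: nat
  assumes "finite I" "s dvd (\<Prod>i\<in>I. n i)"
  shows "\<exists>b. s = (\<Prod>i\<in>I. b i) \<and> (\<forall>i\<in>I. b i dvd n i)"
  using assms
proof (induction I arbitrary: s)
  case (insert x I)
  from insert.prems insert.hyps have "s dvd n x * (\<Prod>i\<in>I. n i)" by simp
  then obtain u w where uw: "s = u * w" "u dvd n x" "w dvd (\<Prod>i\<in>I. n i)" by (rule dvd_productE)
  from insert.IH[OF uw(3)] obtain b where b: "w = (\<Prod>i\<in>I. b i)" "\<forall>i\<in>I. b i dvd n i" by blast
  have "(\<Prod>i\<in>I. (b(x := u)) i) = (\<Prod>i\<in>I. b i)"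
    using insert.hyps by (intro prod.cong) auto
  hence "s = (\<Prod>i\<in>insert x I. (b(x := u)) i) \<and> (\<forall>i\<in>insert x I. (b(x := u)) i dvd n i)"
    using insert.hyps uw b by auto
  thus ?case by blast
qed auto

text \<open>After division by the gcd, the cofactor \<open>s'\<close> of \<open>s\<close> is coprime
  to \<open>z'\<close> and divides \<open>g * z' ^ 2\<close>, hence divides \<open>g\<close>. Then
  its square divides \<open>s\<close>, so it is 1.\<close>

lemma squarefree_mult_square:
  fixes s P :: nat
  assumes "squarefree s" "s * P = z ^ 2" "s > 0"
  obtains w where "P = s * w ^ 2"
proof -
  define g where "g = gcd s z"
  have "g > 0" using assms(3) by (simp add: g_def)
  obtain s' z' where sz: "s = g * s'" "z = g * z'" "coprime s' z'"
    using gcd_coprime_exists[of s z] assms(3) unfolding g_def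
    by (metis gcd_eq_0_iff mult.commute less_numeral_extra(3))
  have "g * (s' * P) = g * (g * z' ^ 2)"
    using assms(2) sz by (simp add: power2_eq_square algebra_simps)
  hence eq: "s' * P = g * z' ^ 2" using \<open>g > 0\<close> by simp
  hence "s' dvd g * z' ^ 2" by (metis dvd_triv_left)
  hence "s' dvd g" using sz(3) by (simp add: coprime_dvd_mult_left_iff)
  hence "s' ^ 2 dvd s" using sz(1) by (simp add: power2_eq_square mult_dvd_mono)
  hence "s' = 1" using assms(1) squarefreeD by fastforce
  thus ?thesis using that[of z'] eq sz by simp
qed

text \<open>Induction on the number of components. If s is the squarefree part of the new one and P
  the product of the old ones, then s P is a square, so P is s times a square and s splits into
  divisors b_i of the n_i. These b_i are the new row of the matrix. Dividing each n_i by b_i leaves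
  a square product, to which the induction hypothesis applies.\<close>

lemma square_product_parametrization:
  assumes "finite I" "\<And>i. i \<in> I \<Longrightarrow> n i > 0" "is_square (\<Prod>i\<in>I. n i)"
  shows "\<exists>d a. (\<forall>i\<in>I. n i = d i ^ 2 * pair_prod I a i)"
  using assms
proof (induction I arbitrary: n)
  case (insert x I)
  define P where "P = (\<Prod>i\<in>I. n i)"
  define s d0 where "s = squarefree_part (n x)" and "d0 = square_part (n x)"
  have nx: "n x = s * d0 ^ 2" unfolding s_def d0_def by (rule squarefree_decompose)
  have "n x > 0" using insert.prems by simp
  hence "s > 0" "d0 > 0" using nx by auto
  have "is_square (d0 ^ 2 * (s * P))"
    using insert.prems(2) insert.hyps nx unfolding P_def by (simp add: mult_ac)
  hence "is_square (s * P)"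
    using is_nth_power_mult_cancel_left[of 2 "d0 ^ 2" "s * P"] \<open>d0 > 0\<close> by simp
  then obtain z where "s * P = z ^ 2" by (auto elim: is_nth_powerE)
  then obtain w where w: "P = s * w ^ 2"
    using squarefree_mult_square[of s P z] \<open>s > 0\<close> by (auto simp: s_def)
  hence "s dvd (\<Prod>i\<in>I. n i)" unfolding P_def by simp
  then obtain b where b: "s = (\<Prod>i\<in>I. b i)" "\<forall>i\<in>I. b i dvd n i"
    using dvd_prod_split[OF insert.hyps(1)] by blast
  define n' where "n' i = n i div b i" for i
  have n': "n i = b i * n' i" if "i \<in> I" for i using b(2) that by (simp add: n'_def)
  have n'_pos: "n' i > 0" if "i \<in> I" for i
    using insert.prems(1)[of i] n'[OF that] that by (auto intro!: Nat.gr0I)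
  have "P = (\<Prod>i\<in>I. b i) * (\<Prod>i\<in>I. n' i)"
    unfolding P_def prod.distrib[symmetric] using n' by (intro prod.cong) auto
  hence "(\<Prod>i\<in>I. n' i) = w ^ 2" using w b(1) \<open>s > 0\<close> by simp
  hence "is_square (\<Prod>i\<in>I. n' i)" by (rule is_nth_powerI)
  with insert.IH[of n'] n'_pos obtain d a where da: "\<forall>i\<in>I. n' i = d i ^ 2 * pair_prod I a i" by blast
  \<comment> \<open>For \<open>q\<close> of the form {x, i}, the \<open>the_elem\<close> expression
    recovers i.\<close>
  define a' where "a' q = (if x \<in> q then b (the_elem (q - {x})) else a q)" for q
  have a'_new: "a' {x, i} = b i" if "i \<in> I" for i
  proof -
    have "{x, i} - {x} = {i}" using insert.hyps(2) that by auto
    thus ?thesis by (simp add: a'_def)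
  qed
  have new: "pair_prod (insert x I) a' x = s"
  proof -
    have "pair_prod (insert x I) a' x = (\<Prod>q\<in>(\<lambda>i. {x, i}) ` I. a' q)"
      unfolding pair_prod_def pairs_of_insert_containing_new[OF insert.hyps(2)] ..
    also have "\<dots> = (\<Prod>i\<in>I. a' {x, i})"
      using insert.hyps(2) by (subst prod.reindex) (auto simp: inj_on_def doubleton_eq_iff)
    also have "\<dots> = (\<Prod>i\<in>I. b i)" using a'_new by (intro prod.cong) auto
    finally show ?thesis using b(1) by simp
  qed
  have old: "pair_prod (insert x I) a' i = b i * pair_prod I a i" if "i \<in> I" for i
  proof -
    have "{x, i} \<notin> {q. q \<in> pairs_of I \<and> i \<in> q}" using insert.hyps(2) by (auto simp: pairs_of_def)
    moreover have "finite {q. q \<in> pairs_of I \<and> i \<in> q}"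
      using finite_pairs_of[OF insert.hyps(1)] by simp
    ultimately have "pair_prod (insert x I) a' i = a' {x, i} * (\<Prod>q | q \<in> pairs_of I \<and> i \<in> q. a' q)"
      unfolding pair_prod_def pairs_of_insert_containing_old[OF insert.hyps(2) that] by simp
    also have "(\<Prod>q | q \<in> pairs_of I \<and> i \<in> q. a' q) = pair_prod I a i"
      unfolding pair_prod_def using insert.hyps(2)
      by (intro prod.cong refl) (auto simp: a'_def pairs_of_def)
    finally show ?thesis using a'_new[OF that] by simp
  qed
  have "\<forall>i\<in>insert x I. n i = (d(x := d0)) i ^ 2 * pair_prod (insert x I) a' i"
  proof
    fix i assume i: "i \<in> insert x I"
    show "n i = (d(x := d0)) i ^ 2 * pair_prod (insert x I) a' i"
    proof (cases "i = x")
      case True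
      thus ?thesis using nx new by simp
    next
      case False
      hence "i \<in> I" using i by simp
      thus ?thesis using False n' da old by simp
    qed
  qed
  thus ?case by blast
qed auto

section \<open>Counting the parameters from above\<close>

lemma card_square_multiples_le:
  assumes "s > 0"
  shows "real (card {d::nat. 0 < d \<and> d ^ 2 * s \<le> y}) \<le> sqrt (real y / real s)"
    and "finite {d::nat. 0 < d \<and> d ^ 2 * s \<le> y}"
proof -
  have sub: "{d::nat. 0 < d \<and> d ^ 2 * s \<le> y} \<subseteq> {1..nat \<lfloor>sqrt (real y / real s)\<rfloor>}"
  proof
    fix d assume d: "d \<in> {d::nat. 0 < d \<and> d ^ 2 * s \<le> y}"
    hence "real (d ^ 2 * s) \<le> real y" by (simp only: of_nat_le_iff mem_Collect_eq)
    hence "real d ^ 2 \<le> real y / real s" using assms by (simp add: field_simps)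
    hence "real d \<le> sqrt (real y / real s)" by (rule real_le_rsqrt)
    hence "d \<le> nat \<lfloor>sqrt (real y / real s)\<rfloor>" by (rule le_nat_floor)
    thus "d \<in> {1..nat \<lfloor>sqrt (real y / real s)\<rfloor>}" using d by simp
  qed
  thus "finite {d::nat. 0 < d \<and> d ^ 2 * s \<le> y}" by (rule finite_subset) simp
  have "card {d::nat. 0 < d \<and> d ^ 2 * s \<le> y} \<le> nat \<lfloor>sqrt (real y / real s)\<rfloor>"
    using card_mono[OF _ sub] by simp
  moreover have "real (nat \<lfloor>sqrt (real y / real s)\<rfloor>) \<le> sqrt (real y / real s)" by simp
  ultimately show "real (card {d::nat. 0 < d \<and> d ^ 2 * s \<le> y}) \<le> sqrt (real y / real s)" by linarith
qed

text \<open>The inductive step is ln u <= u - 1 at u = n / (n + 1).\<close>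

lemma sum_inverse_le_ln:
  assumes "n > 0"
  shows "(\<Sum>t\<in>{1..n}. 1 / real t) \<le> 1 + ln (real n)"
  using assms
proof (induction n)
  case (Suc n)
  show ?case
  proof (cases "n = 0")
    case False
    have "ln (real n / real (Suc n)) \<le> real n / real (Suc n) - 1"
      using False by (intro ln_le_minus_one) auto
    also have "\<dots> = - (1 / real (Suc n))" by (simp add: field_simps)
    also have "ln (real n / real (Suc n)) = ln (real n) - ln (real (Suc n))"
      using False by (intro ln_divide_pos) auto
    finally show ?thesis using Suc.IH False by simp
  qed simp
qed simp

lemma ln_le_sum_inverse: "ln (real n + 1) \<le> (\<Sum>t\<in>{1..n}. 1 / real t)"
proof (induction n)
  case (Suc n)
  have "ln ((real n + 2) / (real n + 1)) \<le> (real n + 2) / (real n + 1) - 1"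
    by (intro ln_le_minus_one) auto
  also have "\<dots> = 1 / (real n + 1)" by (simp add: field_simps)
  also have "ln ((real n + 2) / (real n + 1)) = ln (real n + 2) - ln (real n + 1)"
    by (intro ln_divide_pos) auto
  finally show ?case using Suc.IH by (simp add: add_ac)
qed simp

lemma sqrt_prod: "sqrt (\<Prod>i\<in>I. f i) = (\<Prod>i\<in>I. sqrt (f i))"
  by (induction I rule: infinite_finite_induct) (simp_all add: real_sqrt_mult)

text \<open>A tuple may arise from several choices of parameters, which is harmless for an upper
  bound. The product of all row products is a perfect square by \<open>prod_pair_prod\<close>, so
  the square roots from the counts of the d_i combine to exactly one reciprocal for each entry, and
  the sum over the entries factors.\<close>

lemma card_square_tuples_le:
  assumes "y > 0"
  shows "real (card (square_tuples r y)) \<le> sqrt (real y) ^ r * (1 + ln (real y)) ^ (r choose 2)"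
proof -
  define P where "P = pairs_of {..<r}"
  define A where "A = PiE P (\<lambda>_. {1..y})"
  define s where "s a i = pair_prod {..<r} a i" for a i
  define Ds where "Ds a = PiE {..<r} (\<lambda>i. {d::nat. 0 < d \<and> d ^ 2 * s a i \<le> y})" for a
  define tup where "tup a d = (\<lambda>i\<in>{..<r}. d i ^ 2 * s a i)" for a and d :: "nat \<Rightarrow> nat"
  have finP: "finite P" by (simp add: P_def finite_pairs_of)
  have finA: "finite A" using finP by (auto simp: A_def intro: finite_PiE)
  have s_pos: "s a i > 0" if "a \<in> A" for a i
    using that unfolding s_def pair_prod_def P_def[symmetric]
    by (intro prod_pos) (force simp: A_def PiE_iff)
  have finD: "finite (Ds a)" if "a \<in> A" for a
    unfolding Ds_def using card_square_multiples_le(2)[OF s_pos[OF that]] by (intro finite_PiE) auto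
  have cover: "square_tuples r y \<subseteq> (\<Union>a\<in>A. tup a ` Ds a)"
  proof
    fix n assume "n \<in> square_tuples r y"
    hence n: "n \<in> PiE {..<r} (\<lambda>_. {1..y})" and sq: "is_square (\<Prod>i<r. n i)"
      by (auto simp: square_tuples_def tuples_def)
    have n': "0 < n i" "n i \<le> y" if "i < r" for i using n that by (force simp: PiE_iff)+
    obtain d a where da: "\<forall>i\<in>{..<r}. n i = d i ^ 2 * pair_prod {..<r} a i"
      using square_product_parametrization[of "{..<r}" n] n' sq by auto
    \<comment> \<open>Restriction makes the parameters extensional, as \<open>PiE\<close> demands;
      \<open>pair_prod\<close> reads its argument on pairs alone and does not change.\<close>
    define a' d' where "a' = restrict a P" and "d' = restrict d {..<r}"
    have s_eq: "s a' i = pair_prod {..<r} a i" for i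
      unfolding s_def pair_prod_def by (intro prod.cong) (auto simp: a'_def P_def)
    have eq: "n i = d i ^ 2 * s a' i" if "i < r" for i using da that s_eq by simp
    have "a' \<in> A"
      unfolding A_def
    proof (rule PiE_I)
      fix q assume q: "q \<in> P"
      \<comment> \<open>Either element of the pair will do: the entry divides that component of
        \<open>n\<close> and so lies between 1 and \<open>y\<close>.\<close>
      then obtain i where i: "i \<in> q" "i < r" by (force simp: P_def pairs_of_def card_2_iff)
      have "a' q dvd s a' i"
        unfolding s_def pair_prod_def using q i finP by (intro dvd_prodI) (auto simp: P_def)
      hence "a' q dvd n i" using eq[OF i(2)] by simp
      thus "a' q \<in> {1..y}" using n'[OF i(2)] by (auto dest: dvd_imp_le intro!: Suc_leI Nat.gr0I)
    qed (simp add: a'_def)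
    moreover have "d' \<in> Ds a'"
      unfolding Ds_def
    proof (rule PiE_I)
      fix i assume "i \<in> {..<r}"
      hence i: "i < r" by simp
      show "d' i \<in> {d. 0 < d \<and> d ^ 2 * s a' i \<le> y}"
        using n'[OF i] eq[OF i] i by (auto simp: d'_def intro!: Nat.gr0I)
    qed (simp add: d'_def)
    moreover have "n = tup a' d'"
    proof
      fix i show "n i = tup a' d' i"
        using n eq by (cases "i < r") (auto simp: tup_def d'_def PiE_iff extensional_def)
    qed
    ultimately show "n \<in> (\<Union>a\<in>A. tup a ` Ds a)" by blast
  qed
  have card_D: "real (card (Ds a)) \<le> sqrt (real y) ^ r * (\<Prod>q\<in>P. 1 / real (a q))" if a: "a \<in> A" for a
  proof -
    have "real (card (Ds a)) = (\<Prod>i<r. real (card {d::nat. 0 < d \<and> d ^ 2 * s a i \<le> y}))"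
      unfolding Ds_def by (simp add: card_PiE)
    also have "\<dots> \<le> (\<Prod>i<r. sqrt (real y / real (s a i)))"
      using card_square_multiples_le(1)[OF s_pos[OF a]] by (intro prod_mono) auto
    also have "\<dots> = sqrt (\<Prod>i<r. real y / real (s a i))"
      by (rule sqrt_prod[symmetric])
    also have "(\<Prod>i<r. real y / real (s a i)) = real y ^ r / real (\<Prod>i<r. s a i)"
      by (simp add: prod_dividef)
    also have "(\<Prod>i<r. s a i) = (\<Prod>q\<in>P. a q) ^ 2"
      unfolding s_def P_def by (rule prod_pair_prod) simp
    also have "sqrt (real y ^ r / real ((\<Prod>q\<in>P. a q) ^ 2)) = sqrt (real y) ^ r / real (\<Prod>q\<in>P. a q)"
      by (simp add: real_sqrt_divide real_sqrt_power del: of_nat_prod)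
    finally show ?thesis by (simp add: prod_dividef)
  qed
  have "real (card (square_tuples r y)) \<le> real (card (\<Union>a\<in>A. tup a ` Ds a))"
    using cover finA finD by (simp add: card_mono)
  also have "\<dots> \<le> real (\<Sum>a\<in>A. card (tup a ` Ds a))"
    using finA by (simp only: of_nat_le_iff card_UN_le)
  also have "\<dots> \<le> (\<Sum>a\<in>A. real (card (Ds a)))"
    using finD by (simp add: sum_mono card_image_le)
  also have "\<dots> \<le> (\<Sum>a\<in>A. sqrt (real y) ^ r * (\<Prod>q\<in>P. 1 / real (a q)))"
    by (intro sum_mono card_D)
  also have "\<dots> = sqrt (real y) ^ r * (\<Sum>a\<in>A. \<Prod>q\<in>P. 1 / real (a q))"
    by (rule sum_distrib_left[symmetric])
  also have "(\<Sum>a\<in>A. \<Prod>q\<in>P. 1 / real (a q)) = (\<Prod>q\<in>P. \<Sum>t\<in>{1..y}. 1 / real t)"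
    unfolding A_def using finP by (intro prod_sum_PiE[symmetric]) auto
  also have "\<dots> = (\<Sum>t\<in>{1..y}. 1 / real t) ^ (r choose 2)"
    by (simp add: P_def card_pairs_of)
  also have "sqrt (real y) ^ r * \<dots> \<le> sqrt (real y) ^ r * (1 + ln (real y)) ^ (r choose 2)"
    using sum_inverse_le_ln[OF assms] by (intro mult_left_mono power_mono sum_nonneg) auto
  finally show ?thesis .
qed

section \<open>The lower bound for the weighted number of tuples\<close>

definition phi_ratio :: "nat \<Rightarrow> real" where
  "phi_ratio n = real (totient n) / real n"

lemma phi_ratio_nonneg: "phi_ratio n \<ge> 0"
  by (simp add: phi_ratio_def)

lemma phi_ratio_le_1: "phi_ratio n \<le> 1"
  by (cases "n = 0") (simp_all add: phi_ratio_def totient_le)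

text \<open>A prime dividing both arguments contributes its factor 1 - 1/p twice on the left but
  once on the right.\<close>

lemma phi_ratio_mult_ge: "phi_ratio a * phi_ratio b \<le> phi_ratio (a * b)"
proof -
  have "real (totient a * totient b) \<le> real (totient (a * b))"
    using totient_mult_ge by (simp only: of_nat_le_iff)
  thus ?thesis by (simp add: phi_ratio_def divide_right_mono)
qed

lemma phi_ratio_prod_ge: "(\<Prod>i\<in>I. phi_ratio (f i)) \<le> phi_ratio (\<Prod>i\<in>I. f i)"
proof (induction I rule: infinite_finite_induct)
  case (insert i I)
  have "phi_ratio (f i) * (\<Prod>i\<in>I. phi_ratio (f i)) \<le> phi_ratio (f i) * phi_ratio (\<Prod>i\<in>I. f i)"
    using insert.IH by (intro mult_left_mono phi_ratio_nonneg)
  also have "\<dots> \<le> phi_ratio (f i * (\<Prod>i\<in>I. f i))" by (rule phi_ratio_mult_ge)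
  finally show ?case using insert.hyps by simp
qed (simp_all add: phi_ratio_def)

lemma phi_ratio_square: "phi_ratio (n ^ 2) = phi_ratio n"
  using totient_power[of 2 n] by (simp add: phi_ratio_def power2_eq_square)

text \<open>The Weierstrass product inequality. It replaces products of weights by sums, whose order
  can be exchanged.\<close>

lemma prod_one_minus_ge:
  fixes f :: "'a \<Rightarrow> real"
  assumes "\<And>i. i \<in> I \<Longrightarrow> 0 \<le> f i \<and> f i \<le> 1"
  shows "1 - (\<Sum>i\<in>I. f i) \<le> (\<Prod>i\<in>I. 1 - f i)"
  using assms
proof (induction I rule: infinite_finite_induct)
  case (insert i I)
  have "(\<Prod>i\<in>I. 1 - f i) \<le> 1" using insert.prems by (intro prod_le_1) auto
  hence "f i * (\<Prod>i\<in>I. 1 - f i) \<le> f i * 1" using insert.prems by (intro mult_left_mono) auto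
  moreover have "1 - (\<Sum>i\<in>I. f i) \<le> (\<Prod>i\<in>I. 1 - f i)" using insert by auto
  ultimately have "1 - f i - (\<Sum>i\<in>I. f i) \<le> (1 - f i) * (\<Prod>i\<in>I. 1 - f i)"
    by (simp add: algebra_simps)
  thus ?case using insert.hyps by simp
qed auto

lemma phi_ratio_ge:
  assumes "n > 0"
  shows "1 - (\<Sum>p\<in>prime_factors n. 1 / real p) \<le> phi_ratio n"
proof -
  have "phi_ratio n = (\<Prod>p\<in>prime_factors n. 1 - 1 / real p)"
    using assms totient_formula2[of n] by (simp add: phi_ratio_def)
  also have "\<dots> \<ge> 1 - (\<Sum>p\<in>prime_factors n. 1 / real p)"
  proof (rule prod_one_minus_ge)
    fix p :: nat
    show "0 \<le> 1 / real p \<and> 1 / real p \<le> 1" by (cases "p = 0") simp_all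
  qed
  finally show ?thesis .
qed

text \<open>Telescoping with 1/j^2 <= 1/(j - 1) - 1/j; the induction carries the sharper bound with
  \<open>- 1 / real n\<close>.\<close>

lemma sum_inverse_squares_le:
  assumes "K > 0"
  shows "(\<Sum>j\<in>{K<..n}. 1 / real j ^ 2) \<le> 1 / real K"
proof -
  have "(\<Sum>j\<in>{K<..n}. 1 / real j ^ 2) \<le> 1 / real K - 1 / real n" if "n \<ge> K"
    using that
  proof (induction n rule: dec_induct)
    case (step n)
    have "{K<..Suc n} = insert (Suc n) {K<..n}" using step.hyps by auto
    hence "(\<Sum>j\<in>{K<..Suc n}. 1 / real j ^ 2) = 1 / real (Suc n) ^ 2 + (\<Sum>j\<in>{K<..n}. 1 / real j ^ 2)"
      by simp
    moreover have "1 / real (Suc n) ^ 2 \<le> 1 / real n - 1 / real (Suc n)"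
    proof -
      have "n > 0" using assms step.hyps by simp
      hence "1 / real n - 1 / real (Suc n) = 1 / (real n * real (Suc n))" by (simp add: field_simps)
      also have "\<dots> \<ge> 1 / (real (Suc n) * real (Suc n))"
        using \<open>n > 0\<close> by (intro divide_left_mono mult_right_mono) auto
      finally show ?thesis by (simp add: power2_eq_square)
    qed
    ultimately show ?case using step.IH by linarith
  qed simp
  moreover have "0 \<le> 1 / real n" by simp
  moreover have "{K<..n} = {}" if "n < K" using that by auto
  ultimately show ?thesis by (cases "n \<ge> K") (linarith, simp)
qed

lemma card_multiples_le:
  assumes "p > 0"
  shows "real (card {d\<in>{1..n}. p dvd d}) \<le> real n / real p"
proof -
  have "{d\<in>{1..n}. p dvd d} \<subseteq> (\<lambda>b. p * b) ` {1..n div p}"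
  proof
    fix d assume d: "d \<in> {d\<in>{1..n}. p dvd d}"
    then obtain b where b: "d = p * b" by auto
    have "b \<le> n div p" using d b assms by (simp add: less_eq_div_iff_mult_less_eq mult.commute)
    moreover have "b \<ge> 1" using d b by (cases b) auto
    ultimately show "d \<in> (\<lambda>b. p * b) ` {1..n div p}" using b by auto
  qed
  hence "card {d\<in>{1..n}. p dvd d} \<le> card ((\<lambda>b. p * b) ` {1..n div p})" by (intro card_mono) auto
  also have "\<dots> \<le> n div p" using card_image_le[of "{1..n div p}" "\<lambda>b. p * b"] by simp
  finally have "real (card {d\<in>{1..n}. p dvd d}) \<le> real (n div p)" by simp
  also have "\<dots> \<le> real n / real p" by (rule of_nat_div_le_of_nat)
  finally show ?thesis .
qed

text \<open>By \<open>phi_ratio_ge\<close> the average loss is at most the sum of 1/p^2. Even over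
  all integers p >= 2 in place of primes this is at most 1/4 + 1/2, which leaves 1/4.\<close>

lemma sum_phi_ratio_ge: "real n / 4 \<le> (\<Sum>d\<in>{1..n}. phi_ratio d)"
proof -
  have "(\<Sum>d\<in>{1..n}. \<Sum>p\<in>prime_factors d. 1 / real p) \<le>
      (\<Sum>d\<in>{1..n}. \<Sum>p\<in>{2..n}. if p dvd d then 1 / real p else 0)"
  proof (rule sum_mono)
    fix d assume d: "d \<in> {1..n}"
    have "(\<Sum>p\<in>prime_factors d. 1 / real p) = (\<Sum>p\<in>prime_factors d. if p dvd d then 1 / real p else 0)"
      by (intro sum.cong) auto
    also have "\<dots> \<le> (\<Sum>p\<in>{2..n}. if p dvd d then 1 / real p else 0)"
    proof (rule sum_mono2)
      show "prime_factors d \<subseteq> {2..n}"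
      proof
        fix p assume "p \<in> prime_factors d"
        hence "prime p" "p dvd d" by auto
        thus "p \<in> {2..n}" using d prime_ge_2_nat[of p] dvd_imp_le[of p d] by auto
      qed
    qed auto
    finally show "(\<Sum>p\<in>prime_factors d. 1 / real p) \<le> (\<Sum>p\<in>{2..n}. if p dvd d then 1 / real p else 0)" .
  qed
  also have "\<dots> = (\<Sum>p\<in>{2..n}. \<Sum>d\<in>{1..n}. if p dvd d then 1 / real p else 0)" by (rule sum.swap)
  also have "\<dots> = (\<Sum>p\<in>{2..n}. real (card {d\<in>{1..n}. p dvd d}) / real p)"
    by (intro sum.cong refl) (simp flip: sum.inter_filter)
  also have "\<dots> \<le> (\<Sum>p\<in>{2..n}. real n * (1 / real p ^ 2))"
  proof (intro sum_mono)
    fix p assume "p \<in> {2..n}"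
    hence "real (card {d\<in>{1..n}. p dvd d}) / real p \<le> real n / real p / real p"
      by (intro divide_right_mono card_multiples_le) auto
    thus "real (card {d\<in>{1..n}. p dvd d}) / real p \<le> real n * (1 / real p ^ 2)"
      by (simp add: power2_eq_square)
  qed
  also have "\<dots> = real n * (\<Sum>p\<in>{2..n}. 1 / real p ^ 2)" by (rule sum_distrib_left[symmetric])
  also have "\<dots> \<le> real n * (3 / 4)"
  proof (intro mult_left_mono)
    have "(\<Sum>p\<in>{2..n}. 1 / real p ^ 2) \<le> (\<Sum>p\<in>insert 2 {2<..n}. 1 / real p ^ 2)"
      by (intro sum_mono2) auto
    also have "\<dots> = 1 / 4 + (\<Sum>p\<in>{2<..n}. 1 / real p ^ 2)" by simp
    also have "\<dots> \<le> 1 / 4 + 1 / 2" using sum_inverse_squares_le[of 2 n] by simp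
    finally show "(\<Sum>p\<in>{2..n}. 1 / real p ^ 2) \<le> 3 / 4" by simp
  qed simp
  finally have *: "(\<Sum>d\<in>{1..n}. \<Sum>p\<in>prime_factors d. 1 / real p) \<le> real n * (3 / 4)" .
  have "(\<Sum>d\<in>{1..n}. 1 - (\<Sum>p\<in>prime_factors d. 1 / real p)) \<le> (\<Sum>d\<in>{1..n}. phi_ratio d)"
    by (intro sum_mono phi_ratio_ge) auto
  thus ?thesis using * by (simp add: sum_subtractf)
qed

text \<open>Since \<open>s\<close> is at most \<open>y\<close>, the square root is at least 1 and
  its integer part at least half of it; this turns 1/4 into 1/8.\<close>

lemma sum_phi_ratio_square_multiples_ge:
  assumes "s > 0" "s \<le> y"
  shows "sqrt (real y / real s) / 8 \<le> (\<Sum>d | 0 < d \<and> d ^ 2 * s \<le> y. phi_ratio d)"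
proof -
  define x where "x = sqrt (real y / real s)"
  have x: "x \<ge> 1" using assms by (simp add: x_def)
  have "{1..nat \<lfloor>x\<rfloor>} \<subseteq> {d. 0 < d \<and> d ^ 2 * s \<le> y}"
  proof
    fix d assume d: "d \<in> {1..nat \<lfloor>x\<rfloor>}"
    hence "real d \<le> x" using x by (simp add: le_nat_iff le_floor_iff)
    hence "real d ^ 2 \<le> x ^ 2" by (intro power_mono) auto
    also have "x ^ 2 = real y / real s" by (simp add: x_def)
    finally have "real (d ^ 2 * s) \<le> real y" using assms(1) by (simp add: field_simps)
    thus "d \<in> {d. 0 < d \<and> d ^ 2 * s \<le> y}" using d by (simp only: of_nat_le_iff) auto
  qed
  hence "(\<Sum>d\<in>{1..nat \<lfloor>x\<rfloor>}. phi_ratio d) \<le> (\<Sum>d | 0 < d \<and> d ^ 2 * s \<le> y. phi_ratio d)"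
    using card_square_multiples_le(2)[OF assms(1)] phi_ratio_nonneg by (intro sum_mono2) auto
  moreover have "x / 8 \<le> real (nat \<lfloor>x\<rfloor>) / 4"
  proof -
    have "\<lfloor>x\<rfloor> \<ge> 1" using x by simp
    hence "real (nat \<lfloor>x\<rfloor>) = of_int \<lfloor>x\<rfloor>" "(of_int \<lfloor>x\<rfloor> :: real) \<ge> 1" by simp_all
    moreover have "x < of_int \<lfloor>x\<rfloor> + 1" by linarith
    ultimately show ?thesis by linarith
  qed
  ultimately show ?thesis using sum_phi_ratio_ge[of "nat \<lfloor>x\<rfloor>"] unfolding x_def by linarith
qed

section \<open>Reciprocal sums over integers without small prime factors\<close>

definition coprime_upto :: "nat \<Rightarrow> nat \<Rightarrow> nat set" where
  "coprime_upto Q Z = {t\<in>{1..Z}. coprime t Q}"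

lemma finite_coprime_upto: "finite (coprime_upto Q Z)"
  by (simp add: coprime_upto_def)

text \<open>The residue class 1 modulo \<open>Q\<close> is enough: its u-th member is at most Q u,
  so its reciprocals dominate 1/Q times a harmonic sum.\<close>

lemma sum_inverse_coprime_upto_ge:
  assumes "Q > 0" "Z > 0"
  shows "ln (real Z / real Q) / real Q \<le> (\<Sum>t\<in>coprime_upto Q Z. 1 / real t)"
proof -
  define n where "n = Z div Q"
  have "real Z / real Q \<le> real n + 1"
  proof -
    have "Z = n * Q + Z mod Q" "Z mod Q < Q" using assms(1) by (simp_all add: n_def)
    hence "Z \<le> (n + 1) * Q" by simp
    hence "real Z \<le> real ((n + 1) * Q)" by (simp only: of_nat_le_iff)
    thus ?thesis using assms(1) by (simp add: field_simps)
  qed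
  hence "ln (real Z / real Q) \<le> ln (real n + 1)" using assms by (subst ln_le_cancel_iff) auto
  also have "\<dots> \<le> (\<Sum>u\<in>{1..n}. 1 / real u)" by (rule ln_le_sum_inverse)
  finally have "ln (real Z / real Q) / real Q \<le> (\<Sum>u\<in>{1..n}. 1 / real u) / real Q"
    by (intro divide_right_mono) auto
  also have "\<dots> = (\<Sum>u\<in>{1..n}. 1 / (real Q * real u))"
    by (simp add: sum_divide_distrib mult.commute)
  also have "\<dots> \<le> (\<Sum>u\<in>{1..n}. 1 / real (1 + Q * (u - 1)))"
  proof (intro sum_mono divide_left_mono)
    fix u assume u: "u \<in> {1..n}"
    have "1 + Q * (u - 1) \<le> Q * u" using u assms(1) by (cases u) auto
    thus "real (1 + Q * (u - 1)) \<le> real Q * real u" by (metis of_nat_le_iff of_nat_mult)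
    have "0 < real (1 + Q * (u - 1))" by (simp only: of_nat_0_less_iff)
    thus "0 < real Q * real u * real (1 + Q * (u - 1))" using u assms(1) by (intro mult_pos_pos) auto
  qed auto
  also have "\<dots> = (\<Sum>t\<in>(\<lambda>u. 1 + Q * (u - 1)) ` {1..n}. 1 / real t)"
    using assms(1) by (subst sum.reindex) (auto simp: inj_on_def)
  also have "\<dots> \<le> (\<Sum>t\<in>coprime_upto Q Z. 1 / real t)"
  proof (rule sum_mono2)
    show "(\<lambda>u. 1 + Q * (u - 1)) ` {1..n} \<subseteq> coprime_upto Q Z"
    proof
      fix t assume "t \<in> (\<lambda>u. 1 + Q * (u - 1)) ` {1..n}"
      then obtain u where "t = 1 + Q * (u - 1)" "u \<in> {1..n}" by (rule imageE)
      hence u: "t = 1 + Q * (u - 1)" "1 \<le> u" "u \<le> n" by simp_all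
      have "t \<le> Q * u" using u assms(1) by (cases u) auto
      also have "\<dots> \<le> Q * n" using u by simp
      also have "\<dots> \<le> Z" by (simp add: n_def)
      finally have "t \<le> Z" .
      moreover have "coprime t Q"
      proof (rule coprimeI)
        fix c assume c: "c dvd t" "c dvd Q"
        hence "c dvd Q * (u - 1)" by simp
        thus "is_unit c" using c(1) u(1) by (metis dvd_add_left_iff)
      qed
      ultimately show "t \<in> coprime_upto Q Z" using u by (simp add: coprime_upto_def)
    qed
  qed (auto simp: finite_coprime_upto)
  finally show ?thesis .
qed

text \<open>If t = j b is in the set, so is b. Thus under the weights 1/t divisibility by
  \<open>j\<close> has probability at most 1/j, with no rounding error even for large
  \<open>j\<close>.\<close>

lemma sum_inverse_coprime_upto_dvd_le:
  assumes "j > 0"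
  shows "(\<Sum>t\<in>coprime_upto Q Z. if j dvd t then 1 / real t else 0) \<le>
           (\<Sum>t\<in>coprime_upto Q Z. 1 / real t) / real j"
proof -
  define A where "A = coprime_upto Q Z"
  define B where "B = {b\<in>A. j * b \<in> A}"
  have finA: "finite A" by (simp add: A_def finite_coprime_upto)
  have "{t\<in>A. j dvd t} = (\<lambda>b. j * b) ` B"
  proof (intro equalityI subsetI)
    fix t assume t: "t \<in> {t\<in>A. j dvd t}"
    then obtain b where b: "t = j * b" by auto
    have "b \<in> A" using t b assms unfolding A_def coprime_upto_def
      by (auto intro: order.trans[of b "j * b"])
    thus "t \<in> (\<lambda>b. j * b) ` B" using t b by (auto simp: B_def)
  qed (auto simp: B_def)
  hence "(\<Sum>t\<in>A. if j dvd t then 1 / real t else 0) = (\<Sum>t\<in>(\<lambda>b. j * b) ` B. 1 / real t)"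
    using finA by (simp flip: sum.inter_filter)
  also have "\<dots> = (\<Sum>b\<in>B. 1 / real (j * b))"
    using assms by (subst sum.reindex) (auto simp: inj_on_def)
  also have "\<dots> \<le> (\<Sum>b\<in>A. 1 / real (j * b))"
    using finA by (intro sum_mono2) (auto simp: B_def)
  also have "\<dots> = (\<Sum>b\<in>A. 1 / real b) / real j" by (simp add: sum_divide_distrib mult.commute)
  finally show ?thesis by (simp add: A_def)
qed

text \<open>The weight of a family is a product measure, so divisibility conditions on different
  members are independent.\<close>

lemma sum_PiE_dvd_le:
  fixes Q Z :: nat
  assumes "finite P" "\<And>q. q \<in> P \<Longrightarrow> J q > 0"
  defines "A \<equiv> coprime_upto Q Z"
  shows "(\<Sum>a\<in>PiE P (\<lambda>_. A). if \<forall>q\<in>P. J q dvd a q then \<Prod>q\<in>P. 1 / real (a q) else 0) \<le>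
           (\<Sum>t\<in>A. 1 / real t) ^ card P / real (\<Prod>q\<in>P. J q)"
proof -
  have "(if \<forall>q\<in>P. J q dvd a q then \<Prod>q\<in>P. 1 / real (a q) else 0) =
      (\<Prod>q\<in>P. if J q dvd a q then 1 / real (a q) else 0)" for a :: "_ \<Rightarrow> nat"
    using assms(1) by (auto intro!: prod.cong prod_zero)
  hence "(\<Sum>a\<in>PiE P (\<lambda>_. A). if \<forall>q\<in>P. J q dvd a q then \<Prod>q\<in>P. 1 / real (a q) else 0) =
      (\<Sum>a\<in>PiE P (\<lambda>_. A). \<Prod>q\<in>P. if J q dvd a q then 1 / real (a q) else 0)" by simp
  also have "\<dots> = (\<Prod>q\<in>P. \<Sum>t\<in>A. if J q dvd t then 1 / real t else 0)"
    using assms(1) by (intro prod_sum_PiE[symmetric]) (auto simp: A_def finite_coprime_upto)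
  also have "\<dots> \<le> (\<Prod>q\<in>P. (\<Sum>t\<in>A. 1 / real t) / real (J q))"
    unfolding A_def using assms(2)
    by (intro prod_mono conjI sum_nonneg sum_inverse_coprime_upto_dvd_le) auto
  finally show ?thesis by (simp add: prod_dividef)
qed

section \<open>Squarefree and pairwise coprime families\<close>

definition coprime_families :: "'q set \<Rightarrow> nat \<Rightarrow> nat \<Rightarrow> ('q \<Rightarrow> nat) set" where
  "coprime_families P Q Z = {a \<in> PiE P (\<lambda>_. coprime_upto Q Z).
     (\<forall>q\<in>P. squarefree (a q)) \<and> (\<forall>q\<in>P. \<forall>q'\<in>P. q \<noteq> q' \<longrightarrow> coprime (a q) (a q'))}"

text \<open>Every positive number up to \<open>K\<close> divides \<open>fact K\<close>, so composite
  divisors, such as the gcd of two members, are covered directly.\<close>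

lemma coprime_upto_fact_dvd:
  assumes "t \<in> coprime_upto (fact K) Z" "j dvd t" "j \<noteq> 1"
  shows "j \<in> {K<..Z}"
proof -
  have t: "t > 0" "t \<le> Z" "coprime t (fact K)" using assms(1) by (auto simp: coprime_upto_def)
  have "j > 0" using assms(2) t(1) by (auto intro!: Nat.gr0I)
  moreover have "j \<le> Z" using dvd_imp_le[OF assms(2) t(1)] t(2) by simp
  moreover have "\<not> j \<le> K"
  proof
    assume "j \<le> K"
    hence "j dvd fact K" using \<open>j > 0\<close> by (intro dvd_fact) auto
    hence "is_unit j" using assms(2) t(3) coprime_common_divisor by blast
    thus False using assms(3) by simp
  qed
  ultimately show ?thesis by simp
qed

text \<open>
  Union bound: a family fails to be squarefree and pairwise coprime only if for some \<open>j > K\<close>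
  either \<open>j\<^sup>2\<close> divides a member or \<open>j\<close> divides two members. The loss from the factors
  \<open>phi_ratio\<close> is absorbed in the same way.
\<close>

lemma coprime_families_weight:
  fixes P :: "'q set" and K Z :: nat
  assumes "finite P" "K > 0" "2 * ((card P)\<^sup>2 + 2 * card P) \<le> K"
  shows "(\<Sum>t\<in>coprime_upto (fact K) Z. 1 / real t) ^ card P / 2 \<le>
           (\<Sum>a\<in>coprime_families P (fact K) Z. (\<Prod>q\<in>P. 1 / real (a q)) * (\<Prod>q\<in>P. phi_ratio (a q)))"
proof -
  define A where "A = coprime_upto (fact K) Z"
  define F where "F = PiE P (\<lambda>_. A)"
  define G where "G = coprime_families P (fact K) Z"
  define R where "R = card P"
  define W where "W = (\<Sum>t\<in>A. 1 / real t)"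
  define w where "w a = (\<Prod>q\<in>P. 1 / real (a q))" for a :: "'q \<Rightarrow> nat"
  define ind where "ind J a = (if \<forall>q\<in>P. J q dvd a q then 1 else 0 :: real)" for J a :: "'q \<Rightarrow> nat"
  \<comment> \<open>Divisibility patterns: \<open>J1\<close> asks \<open>j\<close> to divide one
    member, \<open>J2\<close> two members. Their products over \<open>P\<close>, namely j and j^2,
    are the denominators in \<open>sum_PiE_dvd_le\<close>.\<close>
  define J1 where "J1 q j = (\<lambda>x. if x = q then j else 1)" for q :: 'q and j :: nat
  define J2 where "J2 q q' j = (\<lambda>x. J1 q j x * J1 q' j x)" for q q' :: 'q and j :: nat
  define PP where "PP = {(q, q') \<in> P \<times> P. q \<noteq> q'}"
  \<comment> \<open>The three parts record that \<open>j ^ 2\<close> divides a member, that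
    \<open>j\<close> divides two members, and the loss 1/j in the weight of a member divisible by
    \<open>j\<close>. Each of the at most \<open>R ^ 2 + 2 * R\<close> summands has mean at most
    1/j^2.\<close>
  define T where "T j a = (\<Sum>q\<in>P. ind (J1 q (j ^ 2)) a) + (\<Sum>(q, q')\<in>PP. ind (J2 q q' j) a) +
    (\<Sum>q\<in>P. ind (J1 q j) a / real j)" for j a
  have finA: "finite A" by (simp add: A_def finite_coprime_upto)
  have finF: "finite F" using assms(1) finA by (auto simp: F_def intro: finite_PiE)
  have GF: "G \<subseteq> F" by (auto simp: G_def F_def A_def coprime_families_def)
  have finPP: "finite PP" using assms(1) by (auto simp: PP_def intro: finite_subset[of _ "P \<times> P"])
  have cardPP: "card PP \<le> R ^ 2"
    using card_mono[of "P \<times> P" PP] assms(1) by (auto simp: PP_def R_def card_cartesian_product power2_eq_square)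
  have w_nonneg: "w a \<ge> 0" for a by (simp add: w_def prod_nonneg)
  have ind_nonneg: "ind J a \<ge> 0" for J a by (simp add: ind_def)
  have T_nonneg: "T j a \<ge> 0" for j a
    unfolding T_def by (intro add_nonneg_nonneg sum_nonneg) (auto simp: ind_nonneg)
  have W_nonneg: "W \<ge> 0" by (simp add: W_def sum_nonneg)
  have J1_dvd: "ind (J1 q j) a = (if j dvd a q then 1 else 0)" if "q \<in> P" for q j a
    using that by (auto simp: ind_def J1_def)
  have J2_dvd: "ind (J2 q q' j) a = (if j dvd a q \<and> j dvd a q' then 1 else 0)"
    if "(q, q') \<in> PP" for q q' j a
    using that by (auto simp: ind_def J1_def J2_def PP_def)
  have J1_prod: "(\<Prod>x\<in>P. J1 q j x) = j" if "q \<in> P" for q j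
    using that assms(1) unfolding J1_def by (simp add: prod.delta)
  have J2_prod: "(\<Prod>x\<in>P. J2 q q' j x) = j ^ 2" if "(q, q') \<in> PP" for q q' j
    using that J1_prod by (auto simp: J2_def prod.distrib PP_def power2_eq_square)
  have J1_pos: "J1 q j x > 0" if "j > 0" for q j x using that by (simp add: J1_def)
  have J2_pos: "J2 q q' j x > 0" if "j > 0" for q q' j x using that by (simp add: J2_def J1_def)
  have avg: "(\<Sum>a\<in>F. w a * ind J a) \<le> W ^ R / real (\<Prod>q\<in>P. J q)" if "\<And>q. q \<in> P \<Longrightarrow> J q > 0" for J
  proof -
    have "(\<Sum>a\<in>F. w a * ind J a) = (\<Sum>a\<in>F. if \<forall>q\<in>P. J q dvd a q then \<Prod>q\<in>P. 1 / real (a q) else 0)"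
      by (intro sum.cong) (auto simp: ind_def w_def)
    also have "\<dots> \<le> W ^ R / real (\<Prod>q\<in>P. J q)"
      unfolding F_def W_def R_def A_def using assms(1) that by (rule sum_PiE_dvd_le)
    finally show ?thesis .
  qed
  have avg_T: "(\<Sum>a\<in>F. w a * T j a) \<le> W ^ R * real (R ^ 2 + 2 * R) * (1 / real j ^ 2)" if j: "j > 0" for j
  proof -
    have 1: "(\<Sum>a\<in>F. w a * ind (J1 q (j ^ 2)) a) \<le> W ^ R / real j ^ 2" if "q \<in> P" for q
      using avg[of "J1 q (j ^ 2)"] J1_pos[of "j ^ 2"] j unfolding J1_prod[OF that] by simp
    have 2: "(\<Sum>a\<in>F. w a * ind (J2 (fst x) (snd x) j) a) \<le> W ^ R / real j ^ 2" if "x \<in> PP" for x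
    proof -
      have "(fst x, snd x) \<in> PP" using that by simp
      thus ?thesis
        using avg[of "J2 (fst x) (snd x) j"] J2_pos[OF j] unfolding J2_prod[OF \<open>(fst x, snd x) \<in> PP\<close>] by simp
    qed
    have 3: "(\<Sum>a\<in>F. w a * ind (J1 q j) a) / real j \<le> W ^ R / real j ^ 2" if "q \<in> P" for q
    proof -
      have "(\<Sum>a\<in>F. w a * ind (J1 q j) a) / real j \<le> W ^ R / real j / real j"
        using avg[of "J1 q j"] J1_pos[OF j] unfolding J1_prod[OF that] by (intro divide_right_mono) simp_all
      thus ?thesis by (simp add: power2_eq_square)
    qed
    have "(\<Sum>a\<in>F. w a * T j a) = (\<Sum>q\<in>P. \<Sum>a\<in>F. w a * ind (J1 q (j ^ 2)) a) +
        (\<Sum>x\<in>PP. \<Sum>a\<in>F. w a * ind (J2 (fst x) (snd x) j) a) +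
        (\<Sum>q\<in>P. (\<Sum>a\<in>F. w a * ind (J1 q j) a) / real j)"
      unfolding T_def sum_divide_distrib sum.swap[of _ F P] sum.swap[of _ F PP]
      by (simp add: distrib_left sum.distrib sum_distrib_left case_prod_beta)
    also have "\<dots> \<le> (\<Sum>q\<in>P. W ^ R / real j ^ 2) + (\<Sum>x\<in>PP. W ^ R / real j ^ 2) + (\<Sum>q\<in>P. W ^ R / real j ^ 2)"
      by (intro add_mono sum_mono 1 2 3)
    also have "\<dots> = W ^ R / real j ^ 2 * real (card PP + 2 * R)"
      by (simp add: R_def add_divide_distrib algebra_simps)
    also have "\<dots> \<le> W ^ R / real j ^ 2 * real (R ^ 2 + 2 * R)"
      using cardPP W_nonneg by (intro mult_left_mono) auto
    finally show ?thesis by (simp add: mult_ac)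
  qed
  \<comment> \<open>On \<open>G\<close> all prime factors exceed \<open>K\<close>, so
    \<open>phi_ratio_ge\<close> and \<open>prod_one_minus_ge\<close> bound the loss by the third
    part of \<open>T\<close>. Off \<open>G\<close> some \<open>T j a\<close> is at least 1, and the
    left side is not positive.\<close>
  have pointwise: "1 - (\<Sum>j\<in>{K<..Z}. T j a) \<le> (if a \<in> G then \<Prod>q\<in>P. phi_ratio (a q) else 0)" if a: "a \<in> F" for a
  proof -
    have aA: "a q \<in> coprime_upto (fact K) Z" if "q \<in> P" for q using a that by (auto simp: F_def A_def PiE_iff)
    show ?thesis
    proof (cases "a \<in> G")
      case True
      have "(\<Sum>q\<in>P. 1 - phi_ratio (a q)) \<le> (\<Sum>q\<in>P. \<Sum>j\<in>{K<..Z}. ind (J1 q j) a / real j)"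
      proof (rule sum_mono)
        fix q assume q: "q \<in> P"
        have "a q > 0" using aA[OF q] by (simp add: coprime_upto_def)
        hence "1 - phi_ratio (a q) \<le> (\<Sum>p\<in>prime_factors (a q). 1 / real p)"
          using phi_ratio_ge[of "a q"] by simp
        also have "\<dots> = (\<Sum>p\<in>prime_factors (a q). ind (J1 q p) a / real p)"
          using q by (intro sum.cong) (auto simp: J1_dvd)
        also have "\<dots> \<le> (\<Sum>j\<in>{K<..Z}. ind (J1 q j) a / real j)"
        proof (rule sum_mono2)
          show "prime_factors (a q) \<subseteq> {K<..Z}"
          proof
            fix p assume p: "p \<in> prime_factors (a q)"
            hence "p \<noteq> 1" by (auto simp: in_prime_factors_iff)
            thus "p \<in> {K<..Z}" using coprime_upto_fact_dvd[OF aA[OF q]] p by blast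
          qed
        qed (auto simp: ind_nonneg)
        finally show "1 - phi_ratio (a q) \<le> (\<Sum>j\<in>{K<..Z}. ind (J1 q j) a / real j)" .
      qed
      also have "\<dots> = (\<Sum>j\<in>{K<..Z}. \<Sum>q\<in>P. ind (J1 q j) a / real j)" by (rule sum.swap)
      also have "\<dots> \<le> (\<Sum>j\<in>{K<..Z}. T j a)"
        unfolding T_def by (intro sum_mono) (auto intro!: add_nonneg_nonneg sum_nonneg simp: ind_nonneg)
      finally have "1 - (\<Sum>j\<in>{K<..Z}. T j a) \<le> 1 - (\<Sum>q\<in>P. 1 - phi_ratio (a q))" by simp
      also have "\<dots> \<le> (\<Prod>q\<in>P. 1 - (1 - phi_ratio (a q)))"
        by (intro prod_one_minus_ge) (simp add: phi_ratio_nonneg phi_ratio_le_1)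
      finally show ?thesis using True by simp
    next
      case False
      have "\<exists>j\<in>{K<..Z}. T j a \<ge> 1"
      proof -
        have "(\<exists>q\<in>P. \<not> squarefree (a q)) \<or> (\<exists>q\<in>P. \<exists>q'\<in>P. q \<noteq> q' \<and> \<not> coprime (a q) (a q'))"
          using False a by (auto simp: G_def F_def A_def coprime_families_def)
        thus ?thesis
        proof (elim disjE bexE conjE)
          fix q assume q: "q \<in> P" "\<not> squarefree (a q)"
          then obtain j where j: "j ^ 2 dvd a q" "\<not> is_unit j" by (auto simp: squarefree_def)
          have "j dvd a q" using j(1) by (rule dvd_trans[rotated]) simp
          hence "j \<in> {K<..Z}" using coprime_upto_fact_dvd[OF aA[OF q(1)]] j(2) by auto
          have "1 = ind (J1 q (j ^ 2)) a" using j(1) q(1) by (simp add: J1_dvd)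
          hence "1 \<le> (\<Sum>q\<in>P. ind (J1 q (j ^ 2)) a)"
            using member_le_sum[of q P "\<lambda>q. ind (J1 q (j ^ 2)) a"] q(1) assms(1) ind_nonneg by simp
          moreover have "0 \<le> (\<Sum>(q, q')\<in>PP. ind (J2 q q' j) a)" "0 \<le> (\<Sum>q\<in>P. ind (J1 q j) a / real j)"
            by (auto intro!: sum_nonneg simp: ind_nonneg)
          ultimately have "1 \<le> T j a" unfolding T_def by linarith
          thus ?thesis using \<open>j \<in> {K<..Z}\<close> by (rule bexI)
        next
          fix q q' assume q: "q \<in> P" "q' \<in> P" "q \<noteq> q'" "\<not> coprime (a q) (a q')"
          define j where "j = gcd (a q) (a q')"
          have j: "j dvd a q" "j dvd a q'" by (simp_all add: j_def)
          have "j \<noteq> 1" using q(4) by (simp only: j_def coprime_iff_gcd_eq_1 not_False_eq_True)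
          have "j \<in> {K<..Z}" using coprime_upto_fact_dvd[OF aA[OF q(1)] j(1) \<open>j \<noteq> 1\<close>] .
          have mem: "(q, q') \<in> PP" using q by (simp add: PP_def)
          have "1 = ind (J2 q q' j) a" using j mem by (simp add: J2_dvd)
          hence "1 \<le> (\<Sum>(q, q')\<in>PP. ind (J2 q q' j) a)"
            using member_le_sum[of "(q, q')" PP "\<lambda>(q, q'). ind (J2 q q' j) a"] mem finPP ind_nonneg by auto
          moreover have "0 \<le> (\<Sum>q\<in>P. ind (J1 q (j ^ 2)) a)" "0 \<le> (\<Sum>q\<in>P. ind (J1 q j) a / real j)"
            by (auto intro!: sum_nonneg simp: ind_nonneg)
          ultimately have "1 \<le> T j a" unfolding T_def by linarith
          thus ?thesis using \<open>j \<in> {K<..Z}\<close> by (rule bexI)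
        qed
      qed
      then obtain j where "j \<in> {K<..Z}" "T j a \<ge> 1" by blast
      hence "1 \<le> (\<Sum>j\<in>{K<..Z}. T j a)"
        using member_le_sum[of j "{K<..Z}" "\<lambda>j. T j a"] T_nonneg by auto
      thus ?thesis using False by simp
    qed
  qed
  have "(\<Sum>a\<in>F. w a) = W ^ R"
    unfolding w_def F_def W_def R_def using assms(1) finA
    by (subst prod_sum_PiE[symmetric]) auto
  moreover have "(\<Sum>a\<in>F. w a * (\<Sum>j\<in>{K<..Z}. T j a)) \<le> W ^ R / 2"
  proof -
    have "(\<Sum>a\<in>F. w a * (\<Sum>j\<in>{K<..Z}. T j a)) = (\<Sum>j\<in>{K<..Z}. \<Sum>a\<in>F. w a * T j a)"
      unfolding sum_distrib_left by (rule sum.swap)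
    also have "\<dots> \<le> (\<Sum>j\<in>{K<..Z}. W ^ R * real (R ^ 2 + 2 * R) * (1 / real j ^ 2))"
      by (intro sum_mono avg_T) auto
    also have "\<dots> = W ^ R * real (R ^ 2 + 2 * R) * (\<Sum>j\<in>{K<..Z}. 1 / real j ^ 2)"
      by (rule sum_distrib_left[symmetric])
    also have "\<dots> \<le> W ^ R * real (R ^ 2 + 2 * R) * (1 / real K)"
      using W_nonneg assms(2) by (intro mult_left_mono sum_inverse_squares_le) auto
    also have "\<dots> = W ^ R * (real (R ^ 2 + 2 * R) / real K)" by simp
    also have "\<dots> \<le> W ^ R * (1 / 2)"
    proof (intro mult_left_mono)
      have "real (2 * (R ^ 2 + 2 * R)) \<le> real K" using assms(3) unfolding R_def by (simp only: of_nat_le_iff)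
      thus "real (R ^ 2 + 2 * R) / real K \<le> 1 / 2" using assms(2) by (simp add: field_simps)
    qed (use W_nonneg in simp)
    finally show ?thesis by simp
  qed
  ultimately have "W ^ R / 2 \<le> (\<Sum>a\<in>F. w a) - (\<Sum>a\<in>F. w a * (\<Sum>j\<in>{K<..Z}. T j a))" by linarith
  also have "\<dots> = (\<Sum>a\<in>F. w a * (1 - (\<Sum>j\<in>{K<..Z}. T j a)))"
    by (simp add: sum_subtractf right_diff_distrib)
  also have "\<dots> \<le> (\<Sum>a\<in>F. w a * (if a \<in> G then \<Prod>q\<in>P. phi_ratio (a q) else 0))"
    by (intro sum_mono mult_left_mono pointwise w_nonneg)
  also have "\<dots> = (\<Sum>a\<in>G. w a * (\<Prod>q\<in>P. phi_ratio (a q)))"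
    using finF GF by (intro sum.mono_neutral_cong_right) auto
  finally show ?thesis unfolding W_def R_def A_def G_def w_def .
qed

text \<open>The product of the two squarefree parts is a square, so by
  \<open>squarefree_mult_square\<close> the second is the first times a square, which must be
  1.\<close>

lemma square_times_squarefree_unique:
  fixes s s' d d' :: nat
  assumes "squarefree s" "squarefree s'" "d > 0" "d' > 0" "d ^ 2 * s = d' ^ 2 * s'"
  shows "s = s'" and "d = d'"
proof -
  have "s > 0" using assms(1) by (auto intro!: Nat.gr0I)
  have "d' ^ 2 * (s * s') = s * (d ^ 2 * s)" unfolding assms(5) by (simp add: mult_ac)
  also have "\<dots> = (s * d) ^ 2" by (simp add: power2_eq_square mult_ac)
  finally have "is_square (d' ^ 2 * (s * s'))" by (rule is_nth_powerI)
  hence "is_square (s * s')"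
    using is_nth_power_mult_cancel_left[of 2 "d' ^ 2" "s * s'"] assms(4) by simp
  then obtain z where "s * s' = z ^ 2" by (auto elim: is_nth_powerE)
  then obtain w where w: "s' = s * w ^ 2" using squarefree_mult_square assms(1) \<open>s > 0\<close> by metis
  hence "w ^ 2 dvd s'" by simp
  hence "w dvd 1" using assms(2) unfolding squarefree_def by blast
  thus "s = s'" using w by simp
  thus "d = d'" using assms(5) \<open>s > 0\<close> by simp
qed

lemma coprime_families_squarefree:
  assumes "a \<in> coprime_families (pairs_of I) Q Z"
  shows "squarefree (pair_prod I a i)"
  unfolding pair_prod_def using assms
  by (intro squarefree_prod_coprime) (auto simp: coprime_families_def)

text \<open>Rows i and j share only the entry at {i, j}; their other entries belong to distinct
  pairs and are coprime. Hence the row products determine the matrix.\<close>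

lemma coprime_families_gcd:
  assumes "finite I" "a \<in> coprime_families (pairs_of I) Q Z" "i \<noteq> j" "{i, j} \<in> pairs_of I"
  shows "gcd (pair_prod I a i) (pair_prod I a j) = a {i, j}"
proof -
  define rest where "rest x = (\<Prod>q | q \<in> pairs_of I - {{i, j}} \<and> x \<in> q. a q)" for x
  have fin: "finite (pairs_of I)" using assms(1) by (rule finite_pairs_of)
  have split: "pair_prod I a x = a {i, j} * rest x" if "x \<in> {i, j}" for x
  proof -
    have "{q. q \<in> pairs_of I \<and> x \<in> q} = insert {i, j} {q. q \<in> pairs_of I - {{i, j}} \<and> x \<in> q}"
      using assms(4) that by blast
    thus ?thesis unfolding pair_prod_def rest_def using fin by simp
  qed
  have "coprime (rest i) (rest j)"
    unfolding rest_def
  proof (intro prod_coprime_left prod_coprime_right)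
    fix q q' assume q: "q \<in> {q. q \<in> pairs_of I - {{i, j}} \<and> i \<in> q}"
      and q': "q' \<in> {q. q \<in> pairs_of I - {{i, j}} \<and> j \<in> q}"
    have "q \<noteq> q'"
    proof
      assume "q = q'"
      hence "{i, j} \<subseteq> q" "card q = 2" "card {i, j} = 2" using q q' assms(4) by (auto simp: pairs_of_def)
      moreover from this have "finite q" by (intro card_ge_0_finite) simp
      ultimately have "{i, j} = q" by (intro card_subset_eq) auto
      thus False using q by simp
    qed
    thus "coprime (a q) (a q')" using q q' assms(2) by (auto simp: coprime_families_def)
  qed
  thus ?thesis by (simp add: split gcd_mult_distrib_nat[symmetric])
qed

lemma coprime_families_inj:
  assumes "finite I" "a \<in> coprime_families (pairs_of I) Q Z" "a' \<in> coprime_families (pairs_of I) Q Z"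
    and eq: "\<And>i. i \<in> I \<Longrightarrow> pair_prod I a i = pair_prod I a' i"
  shows "a = a'"
proof
  fix q
  show "a q = a' q"
  proof (cases "q \<in> pairs_of I")
    case True
    then obtain i j where ij: "q = {i, j}" "i \<noteq> j" by (auto simp: pairs_of_def card_2_iff)
    hence "i \<in> I" "j \<in> I" using True by (auto simp: pairs_of_def)
    hence "gcd (pair_prod I a i) (pair_prod I a j) = gcd (pair_prod I a' i) (pair_prod I a' j)"
      by (simp add: eq)
    thus ?thesis
      using coprime_families_gcd[OF assms(1,2) ij(2)] coprime_families_gcd[OF assms(1,3) ij(2)] True ij(1)
      by simp
  next
    case False
    thus ?thesis using assms(2,3) by (auto simp: coprime_families_def PiE_iff extensional_def)
  qed
qed

text \<open>The bound on \<open>Z\<close> keeps every row product below \<open>y\<close>, so each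
  d_i has a nonempty range, and \<open>sum_phi_ratio_square_multiples_ge\<close> gives 1/8 for each
  of the \<open>r\<close> components. The weight splits because the product of the tuple is the
  square of the product of all parameters, and \<open>phi_ratio\<close> ignores the square and is
  supermultiplicative.\<close>

lemma sum_phi_ratio_square_tuples_ge:
  assumes "Z > 0" "Z ^ (r choose 2) \<le> y"
  defines "P \<equiv> pairs_of {..<r}"
  shows "(1 / 8) ^ r * sqrt (real y) ^ r *
           (\<Sum>a\<in>coprime_families P Q Z. (\<Prod>q\<in>P. 1 / real (a q)) * (\<Prod>q\<in>P. phi_ratio (a q)))
         \<le> (\<Sum>v\<in>square_tuples r y. phi_ratio (\<Prod>i<r. v i))"
proof -
  define G where "G = coprime_families P Q Z"
  define s where "s a i = pair_prod {..<r} a i" for a i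
  define Ds where "Ds a = PiE {..<r} (\<lambda>i. {d::nat. 0 < d \<and> d ^ 2 * s a i \<le> y})" for a
  define tup where "tup x = (\<lambda>i\<in>{..<r}. (snd x i) ^ 2 * s (fst x) i)"
    for x :: "(nat set \<Rightarrow> nat) \<times> (nat \<Rightarrow> nat)"
  have finP: "finite P" by (simp add: P_def finite_pairs_of)
  have cardP: "card P = r choose 2" by (simp add: P_def card_pairs_of)
  have G: "0 < a q" "a q \<le> Z" if "a \<in> G" "q \<in> P" for a q
    using that by (auto simp: G_def coprime_families_def PiE_iff coprime_upto_def)
  have "G \<subseteq> PiE P (\<lambda>_. coprime_upto Q Z)" by (auto simp: G_def coprime_families_def)
  hence finG: "finite G"
    using finP finite_coprime_upto by (rule finite_subset[OF _ finite_PiE])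
  have s_pos: "s a i > 0" if "a \<in> G" for a i
    using G(1)[OF that] unfolding s_def pair_prod_def P_def[symmetric] by (intro prod_pos) auto
  have s_le: "s a i \<le> y" if "a \<in> G" for a i
  proof -
    have "s a i \<le> (\<Prod>q | q \<in> P \<and> i \<in> q. Z)"
      unfolding s_def pair_prod_def P_def[symmetric] using G(2)[OF that] by (intro prod_mono) auto
    also have "\<dots> = Z ^ card {q. q \<in> P \<and> i \<in> q}" by simp
    also have "\<dots> \<le> Z ^ card P"
      using assms(1) finP by (intro power_increasing card_mono) auto
    finally show ?thesis using assms(2) cardP by simp
  qed
  have finD: "finite (Ds a)" if "a \<in> G" for a
    unfolding Ds_def using card_square_multiples_le(2)[OF s_pos[OF that]] by (intro finite_PiE) auto
  have D: "0 < d i" "d i ^ 2 * s a i \<le> y" if "d \<in> Ds a" "i < r" for a d i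
    using that by (auto simp: Ds_def PiE_iff)
  have tup_prod: "(\<Prod>i<r. tup (a, d) i) = ((\<Prod>i<r. d i) * (\<Prod>q\<in>P. a q)) ^ 2" for a d
  proof -
    have "(\<Prod>i<r. tup (a, d) i) = (\<Prod>i<r. d i ^ 2) * (\<Prod>i<r. s a i)"
      unfolding prod.distrib[symmetric] by (intro prod.cong) (auto simp: tup_def)
    also have "(\<Prod>i<r. s a i) = (\<Prod>q\<in>P. a q) ^ 2"
      unfolding s_def P_def by (rule prod_pair_prod) simp
    finally show ?thesis by (simp add: prod_power_distrib power_mult_distrib)
  qed
  have sub: "tup ` Sigma G Ds \<subseteq> square_tuples r y"
  proof
    fix v assume "v \<in> tup ` Sigma G Ds"
    then obtain a d where v: "v = tup (a, d)" "a \<in> G" "d \<in> Ds a" by auto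
    have "v \<in> tuples r y"
      unfolding tuples_def
    proof (rule PiE_I)
      fix i assume "i \<in> {..<r}"
      hence "i < r" by simp
      thus "v i \<in> {1..y}" using D[OF v(3)] s_pos[OF v(2), of i]
        by (auto simp: v(1) tup_def Suc_le_eq)
    qed (simp add: v(1) tup_def)
    moreover have "is_square (\<Prod>i<r. v i)" unfolding v(1) tup_prod ..
    ultimately show "v \<in> square_tuples r y" by (simp add: square_tuples_def)
  qed
  have inj: "inj_on tup (Sigma G Ds)"
  proof (rule inj_onI)
    fix x x' assume x: "x \<in> Sigma G Ds" "x' \<in> Sigma G Ds" "tup x = tup x'"
    obtain a d where ad: "x = (a, d)" "a \<in> G" "d \<in> Ds a" using x(1) by auto
    obtain a' d' where ad': "x' = (a', d')" "a' \<in> G" "d' \<in> Ds a'" using x(2) by auto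
    have eq: "s a i = s a' i \<and> d i = d' i" if "i < r" for i
    proof -
      have "d i ^ 2 * s a i = d' i ^ 2 * s a' i"
        using fun_cong[OF x(3), of i] that by (simp add: tup_def ad(1) ad'(1))
      moreover have "squarefree (s a i)" "squarefree (s a' i)"
        using coprime_families_squarefree[of a "{..<r}" Q Z i] coprime_families_squarefree[of a' "{..<r}" Q Z i]
          ad(2) ad'(2) unfolding G_def P_def s_def by simp_all
      ultimately show ?thesis
        using square_times_squarefree_unique[of "s a i" "s a' i" "d i" "d' i"]
          D(1)[OF ad(3) that] D(1)[OF ad'(3) that] by blast
    qed
    have "a = a'"
      using ad(2) ad'(2) eq unfolding G_def P_def s_def by (intro coprime_families_inj[of "{..<r}"]) auto
    moreover have "d = d'"
    proof
      fix i show "d i = d' i"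
        using ad(3) ad'(3) eq by (cases "i < r") (auto simp: Ds_def PiE_iff extensional_def)
    qed
    ultimately show "x = x'" by (simp add: ad(1) ad'(1))
  qed
  have fixed_a: "(1 / 8) ^ r * sqrt (real y) ^ r * (\<Prod>q\<in>P. 1 / real (a q)) \<le> (\<Sum>d\<in>Ds a. \<Prod>i<r. phi_ratio (d i))"
    if a: "a \<in> G" for a
  proof -
    have "(\<Prod>i<r. sqrt (real y / real (s a i)) / 8) \<le>
        (\<Prod>i<r. \<Sum>d | 0 < d \<and> d ^ 2 * s a i \<le> y. phi_ratio d)"
      using s_pos[OF a] s_le[OF a] by (intro prod_mono conjI sum_phi_ratio_square_multiples_ge) auto
    also have "\<dots> = (\<Sum>d\<in>Ds a. \<Prod>i<r. phi_ratio (d i))"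
      unfolding Ds_def using card_square_multiples_le(2)[OF s_pos[OF a]] by (intro prod_sum_PiE) auto
    finally have "(\<Prod>i<r. sqrt (real y / real (s a i)) / 8) \<le> (\<Sum>d\<in>Ds a. \<Prod>i<r. phi_ratio (d i))" .
    moreover have "(\<Prod>i<r. sqrt (real y / real (s a i)) / 8) = (1 / 8) ^ r * sqrt (\<Prod>i<r. real y / real (s a i))"
      unfolding sqrt_prod by (simp add: prod_dividef power_one_over)
    moreover have "(\<Prod>i<r. real y / real (s a i)) = real y ^ r / real (\<Prod>i<r. s a i)"
      by (simp add: prod_dividef)
    moreover have "(\<Prod>i<r. s a i) = (\<Prod>q\<in>P. a q) ^ 2"
      unfolding s_def P_def by (rule prod_pair_prod) simp
    moreover have "sqrt (real y ^ r / real ((\<Prod>q\<in>P. a q) ^ 2)) = sqrt (real y) ^ r * (\<Prod>q\<in>P. 1 / real (a q))"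
      by (simp add: real_sqrt_divide real_sqrt_power prod_dividef del: of_nat_prod) simp
    ultimately show ?thesis by (simp only: mult.assoc)
  qed
  have "(1 / 8) ^ r * sqrt (real y) ^ r * (\<Sum>a\<in>G. (\<Prod>q\<in>P. 1 / real (a q)) * (\<Prod>q\<in>P. phi_ratio (a q))) =
      (\<Sum>a\<in>G. ((1 / 8) ^ r * sqrt (real y) ^ r * (\<Prod>q\<in>P. 1 / real (a q))) * (\<Prod>q\<in>P. phi_ratio (a q)))"
    by (simp add: sum_distrib_left mult_ac)
  also have "\<dots> \<le> (\<Sum>a\<in>G. (\<Sum>d\<in>Ds a. \<Prod>i<r. phi_ratio (d i)) * (\<Prod>q\<in>P. phi_ratio (a q)))"
    by (intro sum_mono mult_right_mono fixed_a prod_nonneg) (auto simp: phi_ratio_nonneg)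
  also have "\<dots> = (\<Sum>a\<in>G. \<Sum>d\<in>Ds a. (\<Prod>i<r. phi_ratio (d i)) * (\<Prod>q\<in>P. phi_ratio (a q)))"
    by (simp add: sum_distrib_right)
  also have "\<dots> \<le> (\<Sum>a\<in>G. \<Sum>d\<in>Ds a. phi_ratio (\<Prod>i<r. tup (a, d) i))"
  proof (intro sum_mono)
    fix a d
    have "(\<Prod>i<r. phi_ratio (d i)) * (\<Prod>q\<in>P. phi_ratio (a q)) \<le>
        phi_ratio (\<Prod>i<r. d i) * phi_ratio (\<Prod>q\<in>P. a q)"
      by (intro mult_mono phi_ratio_prod_ge prod_nonneg phi_ratio_nonneg)
    also have "\<dots> \<le> phi_ratio ((\<Prod>i<r. d i) * (\<Prod>q\<in>P. a q))" by (rule phi_ratio_mult_ge)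
    also have "\<dots> = phi_ratio (\<Prod>i<r. tup (a, d) i)" unfolding tup_prod phi_ratio_square ..
    finally show "(\<Prod>i<r. phi_ratio (d i)) * (\<Prod>q\<in>P. phi_ratio (a q)) \<le> phi_ratio (\<Prod>i<r. tup (a, d) i)" .
  qed
  also have "\<dots> = (\<Sum>x\<in>Sigma G Ds. phi_ratio (\<Prod>i<r. tup x i))"
    using finG finD by (subst sum.Sigma) (auto simp: case_prod_beta)
  also have "\<dots> = (\<Sum>v\<in>tup ` Sigma G Ds. phi_ratio (\<Prod>i<r. v i))"
    using inj by (simp add: sum.reindex)
  also have "\<dots> \<le> (\<Sum>v\<in>square_tuples r y. phi_ratio (\<Prod>i<r. v i))"
    using sub finite_tuples phi_ratio_nonneg
    by (intro sum_mono2) (auto simp: square_tuples_def)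
  finally show ?thesis by (simp add: G_def)
qed

lemma sum_phi_ratio_square_tuples_asymp:
  assumes "r \<ge> 2"
  shows "\<exists>c>0. \<exists>y0. \<forall>y\<ge>y0. c * (sqrt (real y) ^ r * ln (real y) ^ (r choose 2)) \<le>
           (\<Sum>v\<in>square_tuples r y. phi_ratio (\<Prod>i<r. v i))"
proof -
  define R where "R = r choose 2"
  \<comment> \<open>Exactly the size that \<open>coprime_families_weight\<close> asks for with
    \<open>R\<close> pairs.\<close>
  define K where "K = 2 * (R\<^sup>2 + 2 * R)"
  define Q :: nat where "Q = fact K"
  define P where "P = pairs_of {..<r}"
  \<comment> \<open>1/8 comes from each d_i. For each logarithm, \<open>R\<close> is lost in the
    root \<open>Z\<close>, 2 in passing from \<open>Z + 1\<close> to \<open>Z / Q\<close>, and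
    \<open>Q\<close> in the coprimality condition. The last 1/2 is the proportion left by the union
    bound.\<close>
  define c where "c = (1 / 8) ^ r * ((1 / (2 * real R * real Q)) ^ R / 2)"
  have R: "R > 0" using assms by (simp add: R_def zero_less_binomial)
  have K: "K > 0" using R by (simp add: K_def)
  have Q: "Q > 0" by (simp add: Q_def)
  have cardP: "card P = R" "finite P" by (simp_all add: P_def R_def card_pairs_of finite_pairs_of)
  have "c * (sqrt (real y) ^ r * ln (real y) ^ R) \<le> (\<Sum>v\<in>square_tuples r y. phi_ratio (\<Prod>i<r. v i))"
    if y: "y \<ge> (2 * Q\<^sup>2) ^ R" for y
  proof -
    \<comment> \<open>The largest \<open>Z\<close> with \<open>Z ^ R\<close> at most
      \<open>y\<close>; its logarithm is still about ln y / R.\<close>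
    define Z where "Z = nth_root_nat R y"
    have Z_ge: "Z \<ge> 2 * Q\<^sup>2" unfolding Z_def using R y by (rule nth_root_nat_ge)
    hence Z: "Z > 0" using Q by (cases Z) auto
    have Z_le: "Z ^ R \<le> y" unfolding Z_def using R by (rule nth_root_nat_power_le)
    have y0: "y > 0" using Z_le Z by (metis gr0I le_zero_eq power_eq_0_iff less_numeral_extra(3))
    have "\<not> (Z + 1) ^ R \<le> y" using nth_root_nat_ge[OF R, of "Z + 1" y] by (auto simp: Z_def)
    hence "real y \<le> real ((Z + 1) ^ R)" by (simp only: of_nat_le_iff)
    hence "ln (real y) \<le> ln (real (Z + 1) ^ R)" using y0 by (subst ln_le_cancel_iff) auto
    also have "\<dots> = real R * ln (real (Z + 1))" by (rule ln_realpow)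
    finally have ln_y: "ln (real y) \<le> real R * ln (real (Z + 1))" .
    \<comment> \<open>This is where \<open>Z\<close> must be at least twice the square of
      \<open>Q\<close>: then \<open>Z + 1\<close> is at most the square of
      \<open>Z / Q\<close>.\<close>
    have "ln (real (Z + 1)) \<le> ln ((real Z / real Q) ^ 2)"
    proof (subst ln_le_cancel_iff)
      have "Q\<^sup>2 * (Z + 1) \<le> Q\<^sup>2 * (2 * Z)" using Z by (intro mult_left_mono) auto
      also have "\<dots> = (2 * Q\<^sup>2) * Z" by simp
      also have "\<dots> \<le> Z * Z" using Z_ge by (intro mult_right_mono) auto
      finally have "real (Q\<^sup>2 * (Z + 1)) \<le> real (Z * Z)" by (simp only: of_nat_le_iff)
      thus "real (Z + 1) \<le> (real Z / real Q) ^ 2"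
        using Q by (simp add: field_simps power2_eq_square)
    qed (use Z Q in auto)
    also have "\<dots> = 2 * ln (real Z / real Q)" using Z Q by (subst ln_realpow) auto
    finally have "ln (real (Z + 1)) \<le> 2 * ln (real Z / real Q)" .
    hence "real R * ln (real (Z + 1)) \<le> real R * (2 * ln (real Z / real Q))" by (intro mult_left_mono) auto
    with ln_y have "ln (real y) \<le> 2 * real R * ln (real Z / real Q)" by simp
    hence "1 / (2 * real R * real Q) * ln (real y) \<le> ln (real Z / real Q) / real Q"
      using R Q by (simp add: field_simps)
    also have "\<dots> \<le> (\<Sum>t\<in>coprime_upto Q Z. 1 / real t)"
      by (rule sum_inverse_coprime_upto_ge[OF Q Z])
    finally have "1 / (2 * real R * real Q) * ln (real y) \<le> (\<Sum>t\<in>coprime_upto Q Z. 1 / real t)" .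
    hence "(1 / (2 * real R * real Q) * ln (real y)) ^ R \<le> (\<Sum>t\<in>coprime_upto Q Z. 1 / real t) ^ R"
      using y0 by (intro power_mono) auto
    hence "(1 / (2 * real R * real Q)) ^ R / 2 * ln (real y) ^ R \<le> (\<Sum>t\<in>coprime_upto Q Z. 1 / real t) ^ R / 2"
      by (subst (asm) power_mult_distrib) linarith
    also have "\<dots> \<le> (\<Sum>a\<in>coprime_families P Q Z. (\<Prod>q\<in>P. 1 / real (a q)) * (\<Prod>q\<in>P. phi_ratio (a q)))"
      using coprime_families_weight[of P K Z] K cardP by (simp add: K_def Q_def)
    finally have "(1 / 8) ^ r * sqrt (real y) ^ r * ((1 / (2 * real R * real Q)) ^ R / 2 * ln (real y) ^ R) \<le>
       (1 / 8) ^ r * sqrt (real y) ^ r *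
       (\<Sum>a\<in>coprime_families P Q Z. (\<Prod>q\<in>P. 1 / real (a q)) * (\<Prod>q\<in>P. phi_ratio (a q)))"
      by (intro mult_left_mono) auto
    also have "\<dots> \<le> (\<Sum>v\<in>square_tuples r y. phi_ratio (\<Prod>i<r. v i))"
      unfolding P_def using Z Z_le unfolding R_def by (rule sum_phi_ratio_square_tuples_ge)
    finally show ?thesis by (simp add: c_def mult_ac)
  qed
  moreover have "c > 0" using R Q by (simp add: c_def)
  ultimately show ?thesis unfolding R_def by blast
qed

section \<open>The order of magnitude of the moments\<close>

text \<open>The error relative to X Y^k: the first term stems from incomplete periods, the second
  from the perfect squares \<open>D\<close>. The latter decays like a power of X.\<close>

lemma error_term_tendsto_0:
  fixes a b :: real
  shows "((\<lambda>X. a / (ln X)\<^sup>2 + b * (X / (ln X)\<^sup>2) powr (1 / 3) * (sqrt X + 1) / X) \<longlongrightarrow> 0) at_top"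
  by real_asymp

lemma sqrt_power_double: "x \<ge> 0 \<Longrightarrow> sqrt x ^ (2 * k) = x ^ k"
  by (simp add: power_mult)

lemma choose_two_double:
  assumes "k \<ge> 1"
  shows "(2 * k) choose 2 = 2 * k\<^sup>2 - k"
proof -
  have "(2 * k) choose 2 = 2 * k * (2 * k - 1) div 2" by (rule choose_two)
  also have "2 * k * (2 * k - 1) = 2 * (2 * k\<^sup>2 - k)"
    by (simp add: power2_eq_square right_diff_distrib' mult_ac)
  finally show ?thesis by simp
qed

text \<open>\<open>A\<close> and \<open>B\<close> are chosen before \<open>c\<close> and
  \<open>C\<close>: the constants in the range of \<open>Y\<close> move only the threshold
  \<open>N\<close>, since for fixed \<open>C\<close> the relative error tends to 0 and ln c, ln C
  are absorbed by ln X.\<close>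

theorem theorem1p1:
  fixes k :: nat and \<epsilon> :: real
  assumes "k \<ge> 1" and "\<epsilon> > 0"
  shows "\<exists>A>0. \<exists>B>0. \<forall>c>0. \<forall>C>0. \<exists>N. \<forall>X\<ge>N. \<forall>Y\<ge>N.
           c * X powr (\<epsilon> / (3 * real k)) \<le> Y \<and>
           Y \<le> C * (X / (ln X)\<^sup>2) powr (1 / (3 * real k)) \<longrightarrow>
             A * (X * Y ^ k * ln X ^ (2 * k\<^sup>2 - k)) \<le> char_moment k X Y \<and>
             char_moment k X Y \<le> B * (X * Y ^ k * ln X ^ (2 * k\<^sup>2 - k))"
proof -
  define R where "R = 2 * k\<^sup>2 - k"
  have R: "(2 * k) choose 2 = R" unfolding R_def using assms(1) by (rule choose_two_double)
  obtain c0 y0 where c0: "c0 > 0" and tuples_ge: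
    "\<And>y. y \<ge> y0 \<Longrightarrow> c0 * (sqrt (real y) ^ (2 * k) * ln (real y) ^ R) \<le>
           (\<Sum>v\<in>square_tuples (2 * k) y. phi_ratio (\<Prod>i<2*k. v i))"
    using sum_phi_ratio_square_tuples_asymp[of "2 * k"] assms(1) unfolding R by auto
  \<comment> \<open>The 1/8 is 1/4 from the density of discriminants, halved to absorb the error.
    The powers of 1/2 and of \<epsilon> / (12 k) come from \<open>Y / 2\<close> <= \<open>y\<close>
    and from \<open>ln_lower\<close>.\<close>
  define A where "A = c0 / 8 * (1 / 2) ^ k * (\<epsilon> / (12 * real k)) ^ R"
  \<comment> \<open>3 bounds \<open>2 * real n + 1\<close> by a multiple of \<open>X\<close>, each 2
    bounds a factor \<open>1 + ln (real y)\<close> by \<open>2 * L\<close>, and the final 1 is for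
    the error.\<close>
  define B where "B = 3 * 2 ^ R + (1 :: real)"
  have A: "A > 0" unfolding A_def using c0 assms by (intro mult_pos_pos zero_less_power) auto
  have B: "B > 0" by (simp add: B_def add_pos_pos)
  have "\<exists>N. \<forall>X\<ge>N. \<forall>Y\<ge>N. c * X powr (\<epsilon> / (3 * real k)) \<le> Y \<and>
           Y \<le> C * (X / (ln X)\<^sup>2) powr (1 / (3 * real k)) \<longrightarrow>
             A * (X * Y ^ k * ln X ^ R) \<le> char_moment k X Y \<and>
             char_moment k X Y \<le> B * (X * Y ^ k * ln X ^ R)" if c: "c > 0" and C: "C > 0" for c C
  proof -
    define err where "err X = 8 * C ^ (3 * k) / (ln X)\<^sup>2 +
      C ^ k * (X / (ln X)\<^sup>2) powr (1 / 3) * (sqrt X + 1) / X" for X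
    have "(err \<longlongrightarrow> 0) at_top"
      unfolding err_def by (rule error_term_tendsto_0)
    hence "\<forall>\<^sub>F X in at_top. err X < min A 1" by (rule order_tendstoD) (use A in simp)
    \<comment> \<open>The three thresholds serve \<open>L ^ R\<close> >= 1, \<open>ln_upper\<close>
      and \<open>ln_lower\<close>; the last makes -ln c at most half of \<epsilon> / (3 k) ln
      X.\<close>
    moreover have "\<forall>\<^sub>F X in at_top. ln X \<ge> max 1 (max (1 + ln C) (- ln c * (6 * real k / \<epsilon>)))"
      using ln_at_top by (rule filterlim_at_top[THEN iffD1, rule_format])
    ultimately have "\<forall>\<^sub>F X in at_top. err X < min A 1 \<and>
        ln X \<ge> max 1 (max (1 + ln C) (- ln c * (6 * real k / \<epsilon>)))"
      by (rule eventually_conj)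
    then obtain X0 where X0: "\<And>X. X \<ge> X0 \<Longrightarrow> err X < min A 1 \<and>
        ln X \<ge> max 1 (max (1 + ln C) (- ln c * (6 * real k / \<epsilon>)))"
      unfolding eventually_at_top_linorder by blast
    show ?thesis
    proof (intro exI[of _ "max X0 (max 4 (real y0))"] allI impI)
      fix X Y :: real
      assume N: "max X0 (max 4 (real y0)) \<le> X" "max X0 (max 4 (real y0)) \<le> Y"
      assume Y: "c * X powr (\<epsilon> / (3 * real k)) \<le> Y \<and> Y \<le> C * (X / (ln X)\<^sup>2) powr (1 / (3 * real k))"
      define L where "L = ln X"
      have X4: "X \<ge> 4" and Y4: "Y \<ge> 4" and "Y \<ge> real y0" using N by auto
      have err: "err X < A" "err X < 1" and L: "L \<ge> 1" "L \<ge> 1 + ln C" "L \<ge> - ln c * (6 * real k / \<epsilon>)"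
        using X0[of X] N by (auto simp: L_def)
      define y n where "y = nat \<lfloor>Y\<rfloor>" and "n = nat \<lfloor>X\<rfloor>"
      have y: "real y \<le> Y" "Y / 2 \<le> real y" "y \<ge> y0" "y > 0"
      proof -
        have "real y = of_int \<lfloor>Y\<rfloor>" using Y4 by (simp add: y_def)
        thus "real y \<le> Y" "Y / 2 \<le> real y" using Y4 by linarith+
        thus "y > 0" using Y4 by auto
        show "y \<ge> y0" unfolding y_def using \<open>Y \<ge> real y0\<close> by (rule le_nat_floor)
      qed
      have n: "2 * real n + 1 \<le> 3 * X" "X \<le> 2 * real n + 1" "real n \<le> X"
      proof -
        have "real n = of_int \<lfloor>X\<rfloor>" using X4 by (simp add: n_def)
        thus "2 * real n + 1 \<le> 3 * X" "X \<le> 2 * real n + 1" "real n \<le> X" using X4 by linarith+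
      qed
      have k: "real k > 0" using assms(1) by simp
      define U where "U = X / L\<^sup>2"
      have U: "U > 0" "U \<le> X"
      proof -
        have "L\<^sup>2 \<ge> 1" using L(1) by (rule one_le_power)
        thus "U > 0" using X4 unfolding U_def by (intro divide_pos_pos) auto
        show "U \<le> X" using divide_left_mono[of 1 "L\<^sup>2" X] \<open>L\<^sup>2 \<ge> 1\<close> X4 L(1) by (simp add: U_def)
      qed
      have Y_le: "Y \<le> C * U powr (1 / (3 * real k))" using Y by (simp add: U_def L_def)
      have Yk: "Y ^ k \<le> C ^ k * U powr (1 / 3)" and Y3k: "Y ^ (3 * k) \<le> C ^ (3 * k) * U"
      proof -
        have "Y ^ k \<le> (C * U powr (1 / (3 * real k))) ^ k" using Y_le Y4 by (intro power_mono) auto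
        also have "\<dots> = C ^ k * U powr (1 / 3)"
          using U(1) k by (simp add: power_mult_distrib powr_realpow[symmetric] powr_powr)
        finally show Yk: "Y ^ k \<le> C ^ k * U powr (1 / 3)" .
        hence "(Y ^ k) ^ 3 \<le> (C ^ k * U powr (1 / 3)) ^ 3" using Y4 by (intro power_mono) auto
        also have "\<dots> = (C ^ k) ^ 3 * U"
          using U(1) by (simp add: power_mult_distrib powr_realpow[symmetric] powr_powr)
        finally show "Y ^ (3 * k) \<le> C ^ (3 * k) * U" by (simp add: power_mult[symmetric] mult.commute)
      qed
      define E where "E = real y ^ (2 * k) * (8 * real y ^ (2 * k) + sqrt n + 1)"
      \<comment> \<open>One factor Y^k is kept for the main term; the remaining Y^(3k) and Y^k are
        bounded by powers of X / (ln X)^2.\<close>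
      have E: "E \<le> X * Y ^ k * err X"
      proof -
        have "E \<le> Y ^ (2 * k) * (8 * Y ^ (2 * k) + sqrt X + 1)"
          unfolding E_def using y n
          by (intro mult_mono add_mono power_mono real_sqrt_le_mono) (auto intro!: add_nonneg_nonneg)
        also have "\<dots> = Y ^ k * (8 * Y ^ (3 * k) + Y ^ k * (sqrt X + 1))"
        proof -
          have "Y ^ (2 * k) = Y ^ k * Y ^ k" "Y ^ (3 * k) = Y ^ k * Y ^ k * Y ^ k"
            by (simp_all add: power_add[symmetric] mult_2 numeral_3_eq_3 add.assoc)
          thus ?thesis by (simp add: algebra_simps)
        qed
        also have "\<dots> \<le> Y ^ k * (8 * (C ^ (3 * k) * U) + C ^ k * U powr (1 / 3) * (sqrt X + 1))"
          using Yk Y3k Y4 X4 by (intro mult_left_mono add_mono mult_right_mono) auto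
        also have "\<dots> = Y ^ k * (X * err X)"
          using X4 by (simp add: err_def U_def L_def field_simps)
        finally show ?thesis by (simp add: mult_ac)
      qed
      have XY: "X * Y ^ k \<ge> 0" using X4 Y4 by simp
      have LR: "L ^ R \<ge> 1" using L(1) by (rule one_le_power)
      have ln_upper: "1 + ln (real y) \<le> 2 * L"
      proof -
        have "ln (real y) \<le> ln (C * X)"
        proof (subst ln_le_cancel_iff)
          have "U powr (1 / (3 * real k)) \<le> X powr (1 / (3 * real k))" using U by (intro powr_mono2) auto
          also have "\<dots> \<le> X powr 1" using X4 assms(1) by (intro powr_mono) (auto simp: field_simps)
          also have "\<dots> = X" using X4 by simp
          finally have "C * U powr (1 / (3 * real k)) \<le> C * X" using C by (intro mult_left_mono) auto
          thus "real y \<le> C * X" using y(1) Y_le by linarith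
        qed (use y C X4 in auto)
        also have "\<dots> = ln C + L" using C X4 by (simp add: ln_mult L_def)
        finally show ?thesis using L(2) by linarith
      qed
      \<comment> \<open>The coefficient \<epsilon> / (3 k) is halved twice: once to absorb ln c,
        once in passing from \<open>Y\<close> to its integer part \<open>y\<close>.\<close>
      have ln_lower: "\<epsilon> / (12 * real k) * L \<le> ln (real y)"
      proof -
        have "ln (c * X powr (\<epsilon> / (3 * real k))) \<le> ln Y" using Y c X4 Y4 by (subst ln_le_cancel_iff) auto
        also have "ln (c * X powr (\<epsilon> / (3 * real k))) = ln c + \<epsilon> / (3 * real k) * L"
          using c X4 by (simp add: ln_mult ln_powr L_def)
        finally have "ln c + \<epsilon> / (3 * real k) * L \<le> ln Y" .
        moreover have "- ln c \<le> \<epsilon> / (6 * real k) * L"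
          using L(3) assms(2) k by (simp add: field_simps)
        moreover have "\<epsilon> / (3 * real k) * L = 2 * (\<epsilon> / (6 * real k) * L)" "\<epsilon> / (6 * real k) * L = 2 * (\<epsilon> / (12 * real k) * L)"
          by simp_all
        moreover have "ln Y \<le> 2 * ln (real y)"
        proof -
          \<comment> \<open>\<open>Y\<close> >= 4 is used here, so that \<open>Y\<close> is at most
            the square of \<open>Y / 2\<close> and hence of \<open>y\<close>.\<close>
          have "Y \<le> (Y / 2)\<^sup>2" using Y4 by (simp add: power2_eq_square)
          also have "\<dots> \<le> real y ^ 2" using y Y4 by (intro power_mono) auto
          finally have "ln Y \<le> ln (real y ^ 2)" using Y4 y by (subst ln_le_cancel_iff) auto
          thus ?thesis using y(4) by (simp add: ln_realpow)
        qed
        ultimately show ?thesis by linarith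
      qed
      have up: "char_moment k X Y \<le> (2 * real n + 1) * card (square_tuples (2 * k) y) + E"
       and low: "(2 * real n + 1) / 4 * (\<Sum>v\<in>square_tuples (2 * k) y. phi_ratio (\<Prod>i<2*k. v i)) - E
          \<le> char_moment k X Y"
        using char_moment_bounds[of X k Y] X4 by (simp_all add: phi_ratio_def E_def y_def n_def)
      have "char_moment k X Y \<le> B * (X * Y ^ k * L ^ R)"
      proof -
        have "real (card (square_tuples (2 * k) y)) \<le> real y ^ k * (1 + ln (real y)) ^ R"
          using card_square_tuples_le[OF y(4), of "2 * k"] unfolding R by (simp add: sqrt_power_double)
        also have "\<dots> \<le> Y ^ k * (2 * L) ^ R"
          using y ln_upper by (intro mult_mono power_mono) auto
        finally have "(2 * real n + 1) * real (card (square_tuples (2 * k) y)) \<le> 3 * X * (Y ^ k * (2 * L) ^ R)"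
          using n X4 by (intro mult_mono) auto
        also have "\<dots> = 3 * 2 ^ R * (X * Y ^ k * L ^ R)" by (simp add: power_mult_distrib)
        finally have 1: "(2 * real n + 1) * real (card (square_tuples (2 * k) y)) \<le> 3 * 2 ^ R * (X * Y ^ k * L ^ R)" .
        have "E \<le> X * Y ^ k * 1" using E mult_left_mono[of "err X" 1 "X * Y ^ k"] XY err by linarith
        also have "\<dots> \<le> X * Y ^ k * L ^ R" using XY LR by (intro mult_left_mono) auto
        finally have "E \<le> X * Y ^ k * L ^ R" .
        with 1 up have "char_moment k X Y \<le> 3 * 2 ^ R * (X * Y ^ k * L ^ R) + X * Y ^ k * L ^ R" by linarith
        thus ?thesis by (simp add: B_def distrib_right)
      qed
      moreover have "A * (X * Y ^ k * L ^ R) \<le> char_moment k X Y"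
      proof -
        have "(Y / 2) ^ k * (\<epsilon> / (12 * real k) * L) ^ R \<le> sqrt (real y) ^ (2 * k) * ln (real y) ^ R"
          using y Y4 L(1) assms ln_lower unfolding sqrt_power_double[OF of_nat_0_le_iff]
          by (intro mult_mono power_mono) auto
        hence "c0 * ((Y / 2) ^ k * (\<epsilon> / (12 * real k) * L) ^ R) \<le>
            (\<Sum>v\<in>square_tuples (2 * k) y. phi_ratio (\<Prod>i<2*k. v i))"
          using tuples_ge[OF y(3)] c0 mult_left_mono by (smt (verit))
        hence "X / 4 * (c0 * ((Y / 2) ^ k * (\<epsilon> / (12 * real k) * L) ^ R)) \<le>
            (2 * real n + 1) / 4 * (\<Sum>v\<in>square_tuples (2 * k) y. phi_ratio (\<Prod>i<2*k. v i))"
          using n X4 c0 Y4 L(1) assms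
          by (intro mult_mono) (auto intro!: mult_nonneg_nonneg sum_nonneg simp: phi_ratio_nonneg)
        moreover have "X / 4 * (c0 * ((Y / 2) ^ k * (\<epsilon> / (12 * real k) * L) ^ R)) = 2 * A * (X * Y ^ k * L ^ R)"
          unfolding A_def power_mult_distrib[of _ L] by (simp add: power_divide mult_ac)
        moreover have "E \<le> A * (X * Y ^ k * L ^ R)"
        proof -
          have "E \<le> X * Y ^ k * A" using E mult_left_mono[of "err X" A "X * Y ^ k"] XY err by linarith
          also have "\<dots> \<le> X * Y ^ k * A * L ^ R" using XY LR A mult_left_mono[of 1 "L ^ R" "X * Y ^ k * A"] by simp
          finally show ?thesis by (simp add: mult_ac)
        qed
        ultimately show ?thesis using low by linarith
      qed
      ultimately show "A * (X * Y ^ k * ln X ^ R) \<le> char_moment k X Y \<and>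
             char_moment k X Y \<le> B * (X * Y ^ k * ln X ^ R)"
        by (simp add: L_def)
    qed
  qed
  thus ?thesis using A B unfolding R_def by blast
qed

end
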